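(* Let $n\ge2$ be an integer, $N=2n+1$, $m_0\in\{+1,-1\}$, $m_N=-m_0$, $m_j=m_0$ and $m_{n+j}=-m_0$ for $1\le j\le n$. Let $0\le\theta_0<2\pi$, $0<a_1<a_2$, $\theta_n^j=\frac{2(j-1)\pi}{n}+\theta_0$ and $\alpha_n^j=\frac{2(j-1)\pi}{n}+\frac{\pi}{n}+\theta_0$ for $1\le j\le n$. Consider the system $$\dot{\mathbf x}_j(t)=2m_j\sum_{k=1,k\ne j}^N m_k\frac{\mathbf x_j(t)-\mathbf x_k(t)}{|\mathbf x_j(t)-\mathbf x_k(t)|^2},\qquad 1\le j\le N,$$ with initial data $\mathbf x_N(0)=\mathbf 0$, $\mathbf x_j(0)=a_1(\cos\theta_n^j,\sin\theta_n^j)^T$, $\mathbf x_{n+j}(0)=a_2(\cos\alpha_n^j,\sin\alpha_n^j)^T$, $1\le j\le n$. Then, on its interval of existence, the solution is of the form $$\mathbf x_N(t)\equiv\mathbf 0,\qquad \mathbf x_j(t)=\sqrt{\rho_1(t)}\,(\cos\theta_n^j,\sin\theta_n^j)^T,\qquad \mathbf x_{n+j}(t)=\sqrt{\rho_2(t)}\,(\cos\alpha_n^j,\sin\alpha_n^j)^T,\qquad 1\le j\le n,$$ where: (i) when $n=2$, only the three vortices $\mathbf x_1(t),\mathbf x_2(t)$ and $\mathbf x_5(t)$ form a collision cluster among the $5$ vortices and they collide at the origin $(0,0)^T$ in finite time; (ii) when $n\ge3$, all the $N=2n+1$ vortices form a collision cluster and they collide at the origin $(0,0)^T$ as $t\to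 T_c:=\frac14(a_1^2+a_2^2)$.
   Context: For a set $I\subseteq\{1,\dots,N\}$ with at least two elements, the vortices in $I$ form a (finite time) collision cluster among the $N$ vortices if there are a finite time $0<T_c<+\infty$ and a point $\mathbf x^0\in\mathbb R^2$ such that, with $d_{jl}(t)=|\mathbf x_j(t)-\mathbf x_l(t)|$, $\min_{1\le j<l\le N}d_{jl}(t)>0$ for $0\le t<T_c$, $\lim_{t\to T_c^-}\mathbf x_j(t)=\mathbf x^0$ for all $j\in I$, and $\min_{j\in I}d_{jl}(t)>0$ for $0\le t\le T_c$ and every $l\in\{1,\dots,N\}\setminus I$ (values at $t=T_c$ understood as limits as $t\to T_c^-$). The solution exists until the first time two of the vortices collide. *)

theory Defs
  imports "HOL-Analysis.Analysis"
begin

text \<open>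
  Vortices are indexed by the naturals \<open>1, ..., N\<close>; the trajectory of vortex \<open>j\<close> is \<open>x j\<close>,
  whose values outside the interval of existence \<open>[0, T)\<close> (where \<open>T = \<infinity>\<close> is allowed) are
  irrelevant.
\<close>

definition existence_interval :: "ereal \<Rightarrow> real set" where
  "existence_interval T = {t. 0 \<le> t \<and> ereal t < T}"

definition vortex_solution ::
    "nat \<Rightarrow> (nat \<Rightarrow> real) \<Rightarrow> ereal \<Rightarrow> (nat \<Rightarrow> real \<Rightarrow> real ^ 2) \<Rightarrow> bool" where
  "vortex_solution N m T x \<longleftrightarrow>
     0 < T \<and>
     (\<forall>t \<in> existence_interval T.
        (\<forall>j\<in>{1..N}. \<forall>k\<in>{1..N}. j \<noteq> k \<longrightarrow> x j t \<noteq> x k t) \<and>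
        (\<forall>j\<in>{1..N}.
           (x j has_vector_derivative
              (2 * m j) *\<^sub>R (\<Sum>k\<in>{1..N} - {j}.
                 m k *\<^sub>R ((x j t - x k t) /\<^sub>R (norm (x j t - x k t))\<^sup>2)))
           (at t within existence_interval T)))"

text \<open>
  Collisions are excluded in \<open>vortex_solution\<close>, so that a maximal solution is one that exists
  until the first collision time.
\<close>

definition maximal_vortex_solution ::
    "nat \<Rightarrow> (nat \<Rightarrow> real) \<Rightarrow> ereal \<Rightarrow> (nat \<Rightarrow> real \<Rightarrow> real ^ 2) \<Rightarrow> bool" where
  "maximal_vortex_solution N m T x \<longleftrightarrow>
     vortex_solution N m T x \<and>
     \<not> (\<exists>T' y. T < T' \<and> vortex_solution N m T' y \<and>
            (\<forall>j\<in>{1..N}. \<forall>t \<in> existence_interval T. y j t = x j t))"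

text \<open>
  The vortices in \<open>I\<close> collide with each other, and with no other vortex, at time \<open>Tc\<close> and
  position \<open>p\<close>.  The requirement \<open>Tc \<le> T\<close> says that the solution exists on \<open>[0, Tc)\<close>.
  The value at \<open>t = Tc\<close> of the distance to a vortex outside \<open>I\<close> is its left limit, whose
  existence is part of the condition.
\<close>

definition cluster_collides_at ::
    "nat \<Rightarrow> ereal \<Rightarrow> (nat \<Rightarrow> real \<Rightarrow> real ^ 2) \<Rightarrow> nat set \<Rightarrow> real \<Rightarrow> real ^ 2 \<Rightarrow> bool" where
  "cluster_collides_at N T x I Tc p \<longleftrightarrow>
     I \<subseteq> {1..N} \<and> 2 \<le> card I \<and>
     0 < Tc \<and> ereal Tc \<le> T \<and>
     (\<forall>t. 0 \<le> t \<and> t < Tc \<longrightarrow>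
        0 < Min {dist (x j t) (x l t) | j l. 1 \<le> j \<and> j < l \<and> l \<le> N}) \<and>
     (\<forall>j\<in>I. (x j \<longlongrightarrow> p) (at_left Tc)) \<and>
     (\<forall>l\<in>{1..N} - I.
        (\<forall>t. 0 \<le> t \<and> t < Tc \<longrightarrow> 0 < Min ((\<lambda>j. dist (x j t) (x l t)) ` I)) \<and>
        (\<exists>d>0. ((\<lambda>t. Min ((\<lambda>j. dist (x j t) (x l t)) ` I)) \<longlongrightarrow> d) (at_left Tc)))"

definition collision_cluster ::
    "nat \<Rightarrow> ereal \<Rightarrow> (nat \<Rightarrow> real \<Rightarrow> real ^ 2) \<Rightarrow> nat set \<Rightarrow> bool" where
  "collision_cluster N T x I \<longleftrightarrow> (\<exists>Tc p. cluster_collides_at N T x I Tc p)"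

definition direction :: "real \<Rightarrow> real ^ 2" where
  "direction \<phi> = vector [cos \<phi>, sin \<phi>]"

end

theory Submission
  imports Defs
begin

text \<open>
  Summing the partial fractions of \<open>n z\<^sup>n\<^sup>-\<^sup>1 / (z\<^sup>n - c)\<close> over each ring shows that every vortex of
  a two-ring configuration is driven radially, so the system reduces to two equations for the
  squared radii, whose sum decreases at the constant rate \<open>4\<close>.  For \<open>n \<ge> 3\<close> both squared radii
  stay positive until their sum vanishes, because the ratio \<open>\<rho>1 / (\<rho>1 + \<rho>2)\<close> obeys a scalar
  equation that leaves \<open>(0, 1)\<close> invariant.  For \<open>n = 2\<close> the reduced system has an explicit solution
  and the inner ring collapses first.  The vortex system is locally Lipschitz away from
  collisions, so the reduced solution agrees with the given one, and maximality forces the latter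
  to live exactly until the collision.
\<close>

subsection \<open>Sums over roots of a complex number\<close>

text \<open>The threshold \<open>n = 3\<close> is read off at the ends of the range of
  \<open>s = \<rho>1 / (\<rho>1 + \<rho>2)\<close>: in rescaled time the rate of \<open>s\<close> is
  \<open>2 * (n - 3)\<close> at \<open>s = 0\<close> and \<open>- 2 * (n + 1)\<close> at
  \<open>s = 1\<close>. For \<open>n \<ge> 3\<close> neither end is crossed; for
  \<open>n = 2\<close> the fraction is driven through \<open>0\<close> while the sum is still
  positive. At \<open>n = 3\<close> the end \<open>s = 0\<close> is an equilibrium, and a merely
  continuous rate could still let \<open>s\<close> reach it. Hence the effort spent on a Lipschitz
  bound for a rate built from square roots; it holds because the roots occur with exponent at least
  \<open>2\<close>. The reduced system is singular where the sum vanishes. Logarithmic time moves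
  that instant to infinity, so a solution for all times is wanted; it comes from a contraction, once
  the rate is extended to a bounded Lipschitz function on the whole line. The plane is read as the
  complex numbers because the interaction kernel is the conjugate of \<open>1 / z\<close>.\<close>

lemma sum_root_powers:
  fixes c :: complex
  assumes "0 < i" "i < n"
  shows "(\<Sum>w | w ^ n = c. w ^ i) = 0"
proof -
  \<comment> \<open>Multiplication by this primitive root permutes the solutions of
    \<open>w ^ n = c\<close>, so the sum equals \<open>z ^ i\<close> times itself. That factor is
    not \<open>1\<close>, since \<open>i / n\<close> lies strictly between two integers.\<close>
  define z where "z = cis (2 * pi / real n)"
  have n: "0 < n" using assms by simp
  have zn: "z ^ n = 1" using n by (simp add: z_def Complex.DeMoivre)
  have z0: "z \<noteq> 0" by (simp add: z_def)
  have zi: "z ^ i \<noteq> 1"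
  proof
    assume "z ^ i = 1"
    then have "cos (2 * pi * (real i / real n)) = 1"
      by (simp add: z_def Complex.DeMoivre complex_eq_iff mult_ac)
    then obtain k :: int where "2 * pi * (real i / real n) = of_int k * 2 * pi"
      using cos_one_2pi_int by blast
    then have "(2 * pi) * (real i / real n) = (2 * pi) * of_int k" by (simp only: mult_ac)
    then have "real i / real n = of_int k" by (subst (asm) mult_left_cancel) auto
    moreover have "0 < real i / real n" "real i / real n < 1" using assms by auto
    ultimately have "0 < k" "k < 1" by simp_all
    then show False by simp
  qed
  have bij: "bij_betw ((*) z) {w. w ^ n = c} {w. w ^ n = c}"
    by (rule bij_betwI[where g = "\<lambda>w. w / z"])
       (auto simp: power_mult_distrib power_divide zn z0)
  have "(\<Sum>w | w ^ n = c. w ^ i) = (\<Sum>w | w ^ n = c. (z * w) ^ i)"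
    using sum.reindex_bij_betw[OF bij, of "\<lambda>w. w ^ i"] by simp
  also have "\<dots> = z ^ i * (\<Sum>w | w ^ n = c. w ^ i)"
    by (simp add: power_mult_distrib sum_distrib_left)
  finally have "(\<Sum>w | w ^ n = c. w ^ i) = z ^ i * (\<Sum>w | w ^ n = c. w ^ i)" .
  then show ?thesis using zi by (metis mult_cancel_right1)
qed

text \<open>Each \<open>(z ^ n - w ^ n) / (z - w)\<close> is a geometric sum in \<open>w\<close>.
  After interchanging the sums only the power \<open>w ^ 0\<close> survives, by
  \<open>sum_root_powers\<close>, and it is counted once for each of the \<open>n\<close>
  roots.\<close>

lemma sum_inverse_diff_roots:
  fixes c z :: complex
  assumes n: "0 < n" and c: "c \<noteq> 0" and zc: "z ^ n \<noteq> c"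
  shows "(\<Sum>w | w ^ n = c. inverse (z - w)) = of_nat n * z ^ (n - 1) / (z ^ n - c)"
proof -
  have "(\<Sum>w | w ^ n = c. inverse (z - w)) * (z ^ n - c)
      = (\<Sum>w | w ^ n = c. \<Sum>i<n. z ^ (n - Suc i) * w ^ i)"
    unfolding sum_distrib_right
  proof (rule sum.cong)
    fix w assume w: "w \<in> {w. w ^ n = c}"
    then have "z \<noteq> w" using zc by auto
    moreover have "z ^ n - c = (z - w) * (\<Sum>i<n. z ^ (n - Suc i) * w ^ i)"
      using w power_diff_sumr2[of w n z] by (simp add: algebra_simps)
    ultimately show "inverse (z - w) * (z ^ n - c) = (\<Sum>i<n. z ^ (n - Suc i) * w ^ i)" by simp
  qed simp
  also have "\<dots> = (\<Sum>i<n. z ^ (n - Suc i) * (\<Sum>w | w ^ n = c. w ^ i))"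
    by (subst sum.swap) (simp add: sum_distrib_left)
  also have "\<dots> = (\<Sum>i<n. if i = 0 then z ^ (n - 1) * of_nat n else 0)"
    using n c by (intro sum.cong) (auto simp: sum_root_powers card_nth_roots)
  also have "\<dots> = of_nat n * z ^ (n - 1)" using n by simp
  finally show ?thesis using zc by (simp add: field_simps)
qed

text \<open>The involution \<open>w \<mapsto> z\<^sup>2 / w\<close> of the roots pairs the summands to \<open>1 / z\<close>.\<close>

lemma sum_inverse_diff_other_roots:
  fixes c z :: complex
  assumes n: "0 < n" and c: "c \<noteq> 0" and z: "z ^ n = c"
  shows "(\<Sum>w \<in> {w. w ^ n = c} - {z}. inverse (z - w)) = of_nat (n - 1) / (2 * z)"
proof -
  let ?R = "{w. w ^ n = c} - {z}"
  have z0: "z \<noteq> 0" using n c z by auto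
  have w0: "w \<noteq> 0" if "w \<in> ?R" for w using that n c by auto
  have bij: "bij_betw (\<lambda>w. z\<^sup>2 / w) ?R ?R"
  proof (rule bij_betwI[where g = "\<lambda>w. z\<^sup>2 / w"])
    show "(\<lambda>w. z\<^sup>2 / w) \<in> ?R \<rightarrow> ?R" "(\<lambda>w. z\<^sup>2 / w) \<in> ?R \<rightarrow> ?R"
      using z z0 w0 c by (auto simp: power_divide field_simps power2_eq_square power_mult_distrib)
  qed (use z0 w0 in \<open>auto simp: field_simps\<close>)
  have pair: "inverse (z - w) + inverse (z - z\<^sup>2 / w) = 1 / z" if "w \<in> ?R" for w
  proof -
    have "w \<noteq> 0" "z - w \<noteq> 0" using w0[OF that] that by auto
    moreover have "z - z\<^sup>2 / w = - z * (z - w) / w"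
      using \<open>w \<noteq> 0\<close> by (simp add: field_simps power2_eq_square)
    ultimately show ?thesis using z0
      by (simp add: divide_simps)
  qed
  have "2 * (\<Sum>w\<in>?R. inverse (z - w)) = (\<Sum>w\<in>?R. inverse (z - w)) + (\<Sum>w\<in>?R. inverse (z - z\<^sup>2 / w))"
    using sum.reindex_bij_betw[OF bij, of "\<lambda>w. inverse (z - w)"] by simp
  also have "\<dots> = (\<Sum>w\<in>?R. 1 / z)"
    unfolding sum.distrib[symmetric] by (intro sum.cong pair) auto
  also have "\<dots> = of_nat (n - 1) / z"
    using n c z card_nth_roots[of c n] finite_nth_roots[of n c] by simp
  finally show ?thesis using z0 by (simp add: field_simps)
qed

subsection \<open>Two-ring configurations\<close>

definition vec_of_complex :: "complex \<Rightarrow> real ^ 2" where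
  "vec_of_complex z = vector [Re z, Im z]"

lemma linear_vec_of_complex: "linear vec_of_complex"
  by (intro linearI) (simp_all add: vec_of_complex_def vec_eq_iff forall_2)

lemma vec_of_complex_simps [simp]:
  "vec_of_complex 0 = 0"
  "vec_of_complex (of_real r * z) = r *\<^sub>R vec_of_complex z"
  "vec_of_complex (r *\<^sub>R z) = r *\<^sub>R vec_of_complex z"
  "vec_of_complex (z - w) = vec_of_complex z - vec_of_complex w"
  by (simp_all add: vec_of_complex_def vec_eq_iff forall_2)

lemma vec_of_complex_sum: "vec_of_complex (sum f A) = (\<Sum>a\<in>A. vec_of_complex (f a))"
  by (rule linear_sum[OF linear_vec_of_complex])

lemma norm_vec_of_complex [simp]: "norm (vec_of_complex z) = cmod z"
  by (simp add: vec_of_complex_def norm_vec_def L2_set_def UNIV_2 cmod_def)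

lemma vec_of_complex_eq_iff [simp]: "vec_of_complex z = vec_of_complex w \<longleftrightarrow> z = w"
  by (auto simp: vec_of_complex_def vec_eq_iff forall_2 complex_eq_iff)

lemma direction_eq_vec_of_complex: "direction \<phi> = vec_of_complex (cis \<phi>)"
  by (simp add: direction_def vec_of_complex_def)

text \<open>Conjugation commutes with real-weighted sums, so this turns a whole vortex velocity into
  the conjugate of a sum of complex inverses.\<close>

lemma inversion_vec_of_complex:
  "vec_of_complex z /\<^sub>R (norm (vec_of_complex z))\<^sup>2 = vec_of_complex (cnj (inverse z))"
proof -
  have "cnj (inverse z) = z /\<^sub>R (cmod z)\<^sup>2"
    using complex_div_cnj[of 1 "cnj z"] by (simp add: inverse_eq_divide scaleR_conv_of_real)
  then show ?thesis by simp
qed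

text \<open>Converts sums over the indices of a ring into sums over all roots of one complex number.
  The vortices are numbered from \<open>1\<close> and the roots of unity from \<open>0\<close>,
  whence the shift.\<close>

lemma bij_betw_ring:
  assumes n: "0 < n" and r: "0 < r"
    and \<phi>: "\<And>k. k \<in> {1..n} \<Longrightarrow> \<phi> k = 2 * (real k - 1) * pi / real n + \<phi>0"
  shows "bij_betw (\<lambda>k. of_real r * cis (\<phi> k)) {1..n} {z. z ^ n = of_real (r ^ n) * cis (real n * \<phi>0)}"
proof -
  let ?c = "of_real r * cis \<phi>0"
  have c: "?c \<noteq> 0" using r by simp
  have cn: "?c ^ n = of_real (r ^ n) * cis (real n * \<phi>0)"
    by (simp only: power_mult_distrib Complex.DeMoivre of_real_power)
  have "bij_betw (\<lambda>k. k - 1) {1..n} {..<n}"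
    by (rule bij_betwI[where g = Suc]) auto
  moreover have "bij_betw (\<lambda>k. cis (2 * pi * real k / real n)) {..<n} {z. z ^ n = 1}"
    using n by (rule Complex.bij_betw_roots_unity)
  moreover have "bij_betw ((*) ?c) {z. z ^ n = 1} {z. z ^ n = ?c ^ n}"
    by (rule bij_betwI[where g = "\<lambda>w. w / ?c"]) (use c in \<open>auto simp: power_mult_distrib power_divide\<close>)
  ultimately have "bij_betw ((*) ?c \<circ> ((\<lambda>k. cis (2 * pi * real k / real n)) \<circ> (\<lambda>k. k - 1)))
      {1..n} {z. z ^ n = ?c ^ n}"
    by (blast intro: bij_betw_trans)
  moreover have "((*) ?c \<circ> ((\<lambda>k. cis (2 * pi * real k / real n)) \<circ> (\<lambda>k. k - 1))) k = of_real r * cis (\<phi> k)"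
    if "k \<in> {1..n}" for k
  proof -
    have "\<phi> k = \<phi>0 + 2 * pi * real (k - 1) / real n"
      using that by (simp add: \<phi>[OF that] of_nat_diff mult_ac)
    then show ?thesis by (simp add: cis_mult mult.assoc)
  qed
  ultimately show ?thesis unfolding cn by (subst (asm) bij_betw_cong) auto
qed

section \<open>Rings as sets of complex roots, and the field they produce\<close>

locale two_rings =
  fixes n N :: nat and m0 \<theta>0 :: real and m \<theta> \<alpha> :: "nat \<Rightarrow> real"
  assumes n: "2 \<le> n" and N: "N = 2 * n + 1" and m0: "m0 \<in> {1, -1}" and mN: "m N = - m0"
    and m1: "\<And>j. j \<in> {1..n} \<Longrightarrow> m j = m0"
    and m2: "\<And>j. j \<in> {1..n} \<Longrightarrow> m (n + j) = - m0"
    and \<theta>: "\<And>j. j \<in> {1..n} \<Longrightarrow> \<theta> j = 2 * (real j - 1) * pi / real n + \<theta>0"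
    and \<alpha>: "\<And>j. j \<in> {1..n} \<Longrightarrow> \<alpha> j = 2 * (real j - 1) * pi / real n + pi / real n + \<theta>0"
begin

definition config :: "real \<Rightarrow> real \<Rightarrow> nat \<Rightarrow> complex" where
  "config r1 r2 k =
    (if k \<le> n then of_real r1 * cis (\<theta> k)
     else if k \<le> 2 * n then of_real r2 * cis (\<alpha> (k - n)) else 0)"

lemma config_simps:
  "j \<in> {1..n} \<Longrightarrow> config r1 r2 j = of_real r1 * cis (\<theta> j)"
  "j \<in> {1..n} \<Longrightarrow> config r1 r2 (n + j) = of_real r2 * cis (\<alpha> j)"
  "config r1 r2 N = 0"
  by (auto simp: config_def N)

lemma index_cases:
  assumes "j \<in> {1..N}"
  obtains (inner) "j \<in> {1..n}" | (outer) i where "j = n + i" "i \<in> {1..n}" | (centre) "j = N"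
proof -
  have "j \<le> n \<or> n < j \<and> j \<le> 2 * n \<or> j = N" using assms by (auto simp: N)
  then consider "j \<le> n" | "n < j" "j \<le> 2 * n" | "j = N" by blast
  then show thesis
  proof cases
    case 2
    then show ?thesis using that(2)[of "j - n"] by (auto simp: le_diff_conv)
  qed (use assms that in auto)
qed

lemma sum_indices:
  fixes f :: "nat \<Rightarrow> 'a :: comm_monoid_add"
  shows "(\<Sum>k\<in>{1..N}. f k) = (\<Sum>k\<in>{1..n}. f k) + (\<Sum>k\<in>{1..n}. f (n + k)) + f N"
proof -
  have "(\<Sum>k\<in>{1..N}. f k) = (\<Sum>k=1..n. f k) + (\<Sum>k=n+1..n+n. f k) + f N"
    using sum.ub_add_nat[of 1 n f n] by (simp add: N mult_2)
  also have "(\<Sum>k=n+1..n+n. f k) = (\<Sum>k\<in>{1..n}. f (n + k))"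
    using sum.shift_bounds_cl_nat_ivl[of f 1 n n] by (simp add: add.commute)
  finally show ?thesis .
qed

abbreviation inner_ring :: "real \<Rightarrow> complex set" where
  "inner_ring r \<equiv> {z. z ^ n = of_real (r ^ n) * cis (real n * \<theta>0)}"

abbreviation outer_ring :: "real \<Rightarrow> complex set" where
  "outer_ring r \<equiv> {z. z ^ n = - of_real (r ^ n) * cis (real n * \<theta>0)}"

lemma bij_betw_inner_ring:
  assumes "0 < r"
  shows "bij_betw (\<lambda>k. of_real r * cis (\<theta> k)) {1..n} (inner_ring r)"
  by (rule bij_betw_ring) (use assms n \<theta> in auto)

text \<open>The angular offset \<open>pi / n\<close> multiplies the \<open>n\<close>-th power by
  \<open>cis pi = -1\<close>; this is the sign in \<open>outer_ring\<close>.\<close>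

lemma bij_betw_outer_ring:
  assumes "0 < r"
  shows "bij_betw (\<lambda>k. of_real r * cis (\<alpha> k)) {1..n} (outer_ring r)"
proof -
  have "real n * (pi / real n + \<theta>0) = pi + real n * \<theta>0" using n by (simp add: field_simps)
  then have "of_real (r ^ n) * cis (real n * (pi / real n + \<theta>0))
      = - of_real (r ^ n) * cis (real n * \<theta>0)"
    by (simp flip: cis_mult)
  moreover have "bij_betw (\<lambda>k. of_real r * cis (\<alpha> k)) {1..n}
      {z. z ^ n = of_real (r ^ n) * cis (real n * (pi / real n + \<theta>0))}"
    by (rule bij_betw_ring) (use assms n \<alpha> in auto)
  ultimately show ?thesis by simp
qed

lemma config_mem_rings:
  "0 < r1 \<Longrightarrow> j \<in> {1..n} \<Longrightarrow> config r1 r2 j \<in> inner_ring r1"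
  "0 < r2 \<Longrightarrow> j \<in> {1..n} \<Longrightarrow> config r1 r2 (n + j) \<in> outer_ring r2"
  using bij_betw_apply[OF bij_betw_inner_ring, of r1 j] bij_betw_apply[OF bij_betw_outer_ring, of r2 j]
  by (simp_all only: config_simps)

text \<open>The \<open>n\<close>-th powers of the two rings lie on opposite rays from the origin, so
  they differ whatever the radii are.\<close>

lemma rings_disjoint:
  assumes "0 < r1" "0 < r2"
  shows "inner_ring r1 \<inter> outer_ring r2 = {}"
proof -
  have "0 < r1 ^ n" "0 < r2 ^ n" using assms by simp_all
  then have "r1 ^ n \<noteq> - (r2 ^ n)" by linarith
  then have "complex_of_real (r1 ^ n) \<noteq> of_real (- (r2 ^ n))"
    by (simp only: of_real_eq_iff not_False_eq_True)
  then have "of_real (r1 ^ n) * cis (real n * \<theta>0) \<noteq> - of_real (r2 ^ n) * cis (real n * \<theta>0)"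
    unfolding of_real_minus mult_right_cancel[OF cis_neq_zero] .
  then show ?thesis
    by (simp only: disjoint_iff mem_Collect_eq) (intro allI impI notI, simp only: not_True_eq_False)
qed

lemma zero_notin_rings:
  assumes "0 < r"
  shows "0 \<notin> inner_ring r" "0 \<notin> outer_ring r"
  using assms n by (auto simp: power_0_left)

text \<open>Rules out collisions as long as both radii are positive.\<close>

lemma inj_on_config:
  assumes r: "0 < r1" "0 < r2"
  shows "inj_on (config r1 r2) {1..N}"
proof (rule inj_onI)
  fix j k assume jk: "j \<in> {1..N}" "k \<in> {1..N}" and eq: "config r1 r2 j = config r1 r2 k"
  note mem = config_mem_rings(1)[OF r(1), of _ r2] config_mem_rings(2)[OF r(2), of _ r1]
  note inj = inj_onD[OF bij_betw_imp_inj_on[OF bij_betw_inner_ring[OF r(1)]]]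
    inj_onD[OF bij_betw_imp_inj_on[OF bij_betw_outer_ring[OF r(2)]]]
  have disj: "z \<in> inner_ring r1 \<Longrightarrow> z \<notin> outer_ring r2" for z
    using rings_disjoint[OF r] by (simp only: disjoint_iff not_False_eq_True)
  note zero = zero_notin_rings(1)[OF r(1)] zero_notin_rings(2)[OF r(2)]
  show "j = k"
    using jk(1)
  proof (cases rule: index_cases)
    case j: inner
    from jk(2) show ?thesis
    proof (cases rule: index_cases)
      case k: inner
      show ?thesis using inj(1)[OF _ j k] eq by (simp only: config_simps(1)[OF j] config_simps(1)[OF k])
    next
      case k: (outer l)
      show ?thesis using disj[OF mem(1)[OF j]] mem(2)[OF k(2)] eq by (simp only: k(1) not_True_eq_False)
    next
      case centre
      show ?thesis using mem(1)[OF j] zero eq by (simp only: centre config_simps(3) not_True_eq_False)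
    qed
  next
    case j: (outer i)
    from jk(2) show ?thesis
    proof (cases rule: index_cases)
      case k: inner
      show ?thesis using disj[OF mem(1)[OF k]] mem(2)[OF j(2)] eq by (simp only: j(1) not_True_eq_False)
    next
      case k: (outer l)
      show ?thesis
        using inj(2)[OF _ j(2) k(2)] eq
        by (simp only: j(1) k(1) config_simps(2)[OF j(2)] config_simps(2)[OF k(2)])
    next
      case centre
      show ?thesis using mem(2)[OF j(2)] zero eq
        by (simp only: j(1) centre config_simps(3) not_True_eq_False)
    qed
  next
    case j: centre
    from jk(2) show ?thesis
    proof (cases rule: index_cases)
      case k: inner
      show ?thesis using mem(1)[OF k] zero eq[symmetric] by (simp only: j config_simps(3) not_True_eq_False)
    next
      case k: (outer l)
      show ?thesis using mem(2)[OF k(2)] zero eq[symmetric]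
        by (simp only: j k(1) config_simps(3) not_True_eq_False)
    qed (use j in simp)
  qed
qed

text \<open>Including the term \<open>k = j\<close> is harmless, since \<open>inverse 0 = 0\<close>.\<close>

lemma config_interaction:
  assumes r: "0 < r1" "0 < r2" and j: "j \<in> {1..N}"
  defines "I \<equiv> \<Sum>k\<in>{1..N}. of_real (m k) * inverse (config r1 r2 j - config r1 r2 k)"
  shows "j \<in> {1..n} \<Longrightarrow> of_real (m j) * I
      = of_real ((real n - 3) / 2 - real n * (r1 ^ n / (r1 ^ n + r2 ^ n))) * inverse (config r1 r2 j)"
    and "j \<in> {n+1..2*n} \<Longrightarrow> of_real (m j) * I
      = of_real ((real n + 1) / 2 - real n * (r2 ^ n / (r1 ^ n + r2 ^ n))) * inverse (config r1 r2 j)"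
    and "j = N \<Longrightarrow> I = 0"
proof -
  have n0: "0 < n" using n by simp
  define c where "c = cis (real n * \<theta>0)"
  have c: "c \<noteq> 0" by (simp add: c_def)
  define z where "z = config r1 r2 j"
  have C1: "of_real (r1 ^ n) * c \<noteq> 0" and C2: "- of_real (r2 ^ n) * c \<noteq> 0" using r c by auto
  have rr: "r1 ^ n + r2 ^ n \<noteq> 0" using r by (metis add_pos_pos less_irrefl zero_less_power)
  then have rr': "complex_of_real (r1 ^ n) + of_real (r2 ^ n) \<noteq> 0"
    by (metis of_real_add of_real_eq_0_iff)
  have mm: "of_real m0 * of_real m0 = (1 :: complex)" using m0 by auto
  have "I = (\<Sum>k\<in>{1..n}. of_real m0 * inverse (z - of_real r1 * cis (\<theta> k)))
      + (\<Sum>k\<in>{1..n}. - of_real m0 * inverse (z - of_real r2 * cis (\<alpha> k))) - of_real m0 * inverse z"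
    unfolding I_def sum_indices z_def[symmetric] by (simp add: config_simps m1 m2 mN)
  also have "\<dots> = of_real m0 * ((\<Sum>w\<in>inner_ring r1. inverse (z - w)) - (\<Sum>w\<in>outer_ring r2. inverse (z - w)) - inverse z)"
    using sum.reindex_bij_betw[OF bij_betw_inner_ring[OF r(1)], of "\<lambda>w. inverse (z - w)"]
      sum.reindex_bij_betw[OF bij_betw_outer_ring[OF r(2)], of "\<lambda>w. inverse (z - w)"]
    by (simp add: sum_distrib_left[symmetric] sum_negf algebra_simps del: of_real_power)
  finally have I: "I = of_real m0 * ((\<Sum>w | w ^ n = of_real (r1 ^ n) * c. inverse (z - w))
      - (\<Sum>w | w ^ n = - of_real (r2 ^ n) * c. inverse (z - w)) - inverse z)"
    by (simp only: c_def)
  have self: "(\<Sum>w | w ^ n = d. inverse (z - w)) = of_nat (n - 1) / (2 * z)" if "z ^ n = d" "d \<noteq> 0" for d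
  proof -
    have "(\<Sum>w | w ^ n = d. inverse (z - w)) = inverse (z - z) + (\<Sum>w\<in>{w. w ^ n = d} - {z}. inverse (z - w))"
      using that n0 by (intro sum.remove finite_nth_roots) auto
    then show ?thesis using sum_inverse_diff_other_roots[OF n0 that(2,1)] by simp
  qed
  \<comment> \<open>Up to sign both rings carry the same phase \<open>c\<close>. Its cancellation
    leaves a real multiple of \<open>inverse z\<close>, which is what makes the velocity
    radial.\<close>
  have cancel_phase: "k * (a * c / z) / (d * c) = k * (a / d) * inverse z"
    if "d \<noteq> 0" "z \<noteq> 0" for k a d using that c by (simp add: field_simps)
  \<comment> \<open>The centre has strength \<open>- m0\<close>, opposite to the inner ring and
    equal to the outer one; it shifts the coefficient \<open>(n - 1) / 2\<close> of the own ring by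
    \<open>-1\<close> and by \<open>+1\<close> respectively.\<close>
  have collect: "of_nat (n - 1) / (2 * z) - of_nat n * q * inverse z - inverse z
        = ((of_nat n - 3) / 2 - of_nat n * q) * inverse z"
      "of_nat (n - 1) / (2 * z) - of_nat n * q * inverse z + inverse z
        = ((of_nat n + 1) / 2 - of_nat n * q) * inverse z" if "z \<noteq> 0" for q
    using that n0 by (simp_all add: of_nat_diff divide_simps)
  have zpow: "z ^ (n - 1) = z ^ n / z" if "z \<noteq> 0" using that n0 by (simp add: power_diff)
  {
    assume "j \<in> {1..n}"
    then have mj: "m j = m0" and zn: "z ^ n = of_real (r1 ^ n) * c"
      using m1 config_mem_rings(1)[OF r(1), of j r2] by (simp_all add: z_def c_def)
    have z0: "z \<noteq> 0" using zn C1 n0 by (metis power_0_left less_numeral_extra(3))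
    have d: "z ^ n - - of_real (r2 ^ n) * c = (of_real (r1 ^ n) + of_real (r2 ^ n)) * c"
      unfolding zn by (simp add: algebra_simps)
    then have "z ^ n \<noteq> - of_real (r2 ^ n) * c" using rr' c by (metis mult_eq_0_iff right_minus_eq)
    note other = sum_inverse_diff_roots[OF n0 C2 this]
    have o: "(\<Sum>w | w ^ n = - of_real (r2 ^ n) * c. inverse (z - w))
        = of_nat n * (of_real (r1 ^ n) / (of_real (r1 ^ n) + of_real (r2 ^ n))) * inverse z"
      unfolding other d zpow[OF z0] unfolding zn by (simp only: cancel_phase[OF rr' z0])
    have "of_real (m j) * I = of_nat (n - 1) / (2 * z)
        - of_nat n * (of_real (r1 ^ n) / (of_real (r1 ^ n) + of_real (r2 ^ n))) * inverse z - inverse z"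
      unfolding I o self[OF zn C1] mj mult.assoc[symmetric] mm by simp
    then show "of_real (m j) * I
      = of_real ((real n - 3) / 2 - real n * (r1 ^ n / (r1 ^ n + r2 ^ n))) * inverse (config r1 r2 j)"
      unfolding z_def[symmetric] collect[OF z0] by (simp del: of_real_power)
  }
  {
    assume "j \<in> {n+1..2*n}"
    then have i: "j = n + (j - n)" "j - n \<in> {1..n}" by auto
    have mj: "m j = - m0" using m2[OF i(2)] i(1) by simp
    have zn: "z ^ n = - of_real (r2 ^ n) * c"
      using config_mem_rings(2)[OF r(2) i(2), of r1] i(1) by (simp add: z_def c_def)
    have z0: "z \<noteq> 0" using zn C2 n0 by (metis power_0_left less_numeral_extra(3))
    have d: "z ^ n - of_real (r1 ^ n) * c = - ((of_real (r1 ^ n) + of_real (r2 ^ n)) * c)"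
      unfolding zn by (simp add: algebra_simps)
    then have "z ^ n \<noteq> of_real (r1 ^ n) * c" using rr' c by (metis mult_eq_0_iff right_minus_eq neg_equal_0_iff_equal)
    note other = sum_inverse_diff_roots[OF n0 C1 this]
    have o: "(\<Sum>w | w ^ n = of_real (r1 ^ n) * c. inverse (z - w))
        = of_nat n * (of_real (r2 ^ n) / (of_real (r1 ^ n) + of_real (r2 ^ n))) * inverse z"
      unfolding other d zpow[OF z0] unfolding zn
      by (simp only: mult_minus_left mult_minus_right minus_divide_left[symmetric]
          minus_divide_right[symmetric] minus_minus
          cancel_phase[OF rr' z0])
    have "of_real (m j) * I = of_nat (n - 1) / (2 * z)
        - of_nat n * (of_real (r2 ^ n) / (of_real (r1 ^ n) + of_real (r2 ^ n))) * inverse z + inverse z"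
      unfolding I o self[OF zn C2]
      unfolding mj of_real_minus mult_minus_left mult.assoc[symmetric] mm by simp
    then show "of_real (m j) * I
      = of_real ((real n + 1) / 2 - real n * (r2 ^ n / (r1 ^ n + r2 ^ n))) * inverse (config r1 r2 j)"
      unfolding z_def[symmetric] collect[OF z0] by (simp del: of_real_power)
  }
  {
    assume "j = N"
    then have z: "z = 0" by (simp add: z_def config_simps)
    \<comment> \<open>At the centre the numerator \<open>z ^ (n - 1)\<close> is zero because
      \<open>n \<ge> 2\<close>; the remaining term of \<open>I\<close> is
      \<open>inverse 0 = 0\<close>.\<close>
    have *: "(\<Sum>w | w ^ n = d. inverse (z - w)) = 0" if "d \<noteq> 0" for d
      using sum_inverse_diff_roots[OF n0 that, of z] that n by (simp add: z power_0_left)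
    show "I = 0" unfolding I *[OF C1] *[OF C2] by (simp add: z)
  }
qed

end

subsection \<open>Scalar differential equations\<close>

text \<open>Picard iteration on the whole half-line, with the supremum norm weighted by
  \<open>exp (- 2 * L * t)\<close>: this weight makes the integral operator a contraction with
  factor \<open>1 / 2\<close> in one go. Boundedness of \<open>g\<close> gives linear growth, so the
  weighted iterates are bounded functions.\<close>

lemma global_ODE_solution:
  fixes g :: "real \<Rightarrow> real"
  assumes lip: "\<And>y z. \<bar>g y - g z\<bar> \<le> L * \<bar>y - z\<bar>" and bd: "\<And>y. \<bar>g y\<bar> \<le> M" and L: "0 < L"
  obtains u where "u 0 = u0"
    "\<And>t. 0 \<le> t \<Longrightarrow> (u has_real_derivative g (u t)) (at t within {0..})"
proof -
  have M: "0 \<le> M" using bd[of 0] by linarith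
  have gc: "continuous_on A g" for A
  proof (rule continuous_on_subset[OF lipschitz_on_continuous_on])
    show "L-lipschitz_on UNIV g"
      using lip L by (intro lipschitz_onI) (auto simp: dist_real_def)
  qed simp
  \<comment> \<open>The unknown \<open>v\<close> is the weighted function
    \<open>exp (- 2 * L * t) * u t\<close>; the factor \<open>exp (2 * L * x)\<close> recovers
    \<open>u\<close> before \<open>g\<close> is applied.\<close>
  define E where "E v x = g (exp (2 * L * x) * apply_bcontfun v x)" for v :: "real \<Rightarrow>\<^sub>C real" and x
  have Ec: "continuous_on A (E v)" for A v
    unfolding E_def
    by (rule continuous_on_compose2[OF gc[of UNIV]]) (auto intro!: continuous_intros)
  have Ei: "E v integrable_on {a..b}" for v a b
    by (rule integrable_continuous_real[OF Ec])
  \<comment> \<open>\<open>max 0 t\<close> extends the iterate constantly to negative times, since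
    bounded continuous functions here live on the whole line.\<close>
  define F where "F v t = exp (- (2 * L * max 0 t)) * (u0 + integral {0..max 0 t} (E v))" for v t
  have Fb: "F v \<in> bcontfun" for v
  proof (rule bcontfun_normI)
    have cb: "continuous_on {0..b} (\<lambda>t. integral {0..t} (E v))" for b
      by (rule indefinite_integral_continuous_1[OF Ei])
    have *: "continuous_on {0..} (\<lambda>t. integral {0..t} (E v))"
      unfolding continuous_on_eq_continuous_within
    proof
      fix t :: real assume "t \<in> {0..}"
      then have "continuous (at t within {0..t + 1}) (\<lambda>t. integral {0..t} (E v))"
        using cb[of "t + 1"]
        by (auto simp: continuous_on_eq_continuous_within)
      moreover have "at t within {0..t + 1} = at t within {0..}"
        using \<open>t \<in> _\<close> by (intro at_within_nhd[where S = "{t - 1<..<t + 1}"]) auto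
      ultimately show "continuous (at t within {0..}) (\<lambda>t. integral {0..t} (E v))" by simp
    qed
    show "continuous_on UNIV (F v)"
      unfolding F_def
      by (intro continuous_intros continuous_on_compose2[OF *]) auto
    fix t :: real
    let ?t = "max 0 t"
    have "\<bar>integral {0..?t} (E v)\<bar> \<le> M * ?t"
      using integral_bound[of 0 ?t "E v" M] Ec bd by (simp add: E_def)
    then have "\<bar>u0 + integral {0..?t} (E v)\<bar> \<le> \<bar>u0\<bar> + M * ?t" by linarith
    then have "norm (F v t) \<le> exp (- (2 * L * ?t)) * (\<bar>u0\<bar> + M * ?t)"
      by (simp add: F_def abs_mult)
    also have "\<dots> = exp (- (2 * L * ?t)) * \<bar>u0\<bar> + M * (?t * exp (- (2 * L * ?t)))"
      by (simp add: algebra_simps)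
    also have "\<dots> \<le> 1 * \<bar>u0\<bar> + M * (1 / (2 * L))"
    proof (intro add_mono mult_right_mono mult_left_mono)
      have "2 * L * ?t \<le> exp (2 * L * ?t)" using exp_ge_add_one_self[of "2 * L * ?t"] by linarith
      then show "?t * exp (- (2 * L * ?t)) \<le> 1 / (2 * L)"
        using L by (simp add: exp_minus divide_simps mult.commute)
    qed (use M L in auto)
    finally show "norm (F v t) \<le> 1 * \<bar>u0\<bar> + M * (1 / (2 * L))" .
  qed
  define G where "G v = Bcontfun (F v)" for v
  have G: "apply_bcontfun (G v) = F v" for v
    by (simp add: G_def Bcontfun_inverse Fb)
  have "\<exists>!v. G v = v"
  proof (rule banach_fix_type[of "1 / 2"]; (intro allI)?)
    fix v w
    show "dist (G v) (G w) \<le> 1 / 2 * dist v w"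
    proof (rule dist_bound)
      fix t :: real
      let ?t = "max 0 t" and ?d = "dist v w"
      \<comment> \<open>Integrating \<open>L * exp (2 * L * x)\<close> produces the factor
        \<open>1 / 2\<close>, and the growing exponential is absorbed by the weight.\<close>
      have ig: "((\<lambda>x. L * ?d * exp (2 * L * x)) has_integral
          (?d / 2 * exp (2 * L * ?t) - ?d / 2 * exp (2 * L * 0))) {0..?t}"
        by (rule fundamental_theorem_of_calculus)
           (auto intro!: derivative_eq_intros simp flip: has_real_derivative_iff_has_vector_derivative)
      have "\<bar>integral {0..?t} (E v) - integral {0..?t} (E w)\<bar>
          = norm (integral {0..?t} (\<lambda>x. E v x - E w x))"
        by (simp add: Henstock_Kurzweil_Integration.integral_diff Ei)
      also have "\<dots> \<le> integral {0..?t} (\<lambda>x. L * ?d * exp (2 * L * x))"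
      proof (rule integral_norm_bound_integral)
        show "(\<lambda>x. E v x - E w x) integrable_on {0..?t}" by (intro integrable_diff Ei)
        show "(\<lambda>x. L * ?d * exp (2 * L * x)) integrable_on {0..?t}" using ig by blast
        fix x
        have "norm (E v x - E w x)
            \<le> L * \<bar>exp (2 * L * x) * apply_bcontfun v x - exp (2 * L * x) * apply_bcontfun w x\<bar>"
          unfolding E_def by (simp add: lip)
        also have "\<dots> = L * (exp (2 * L * x) * dist (apply_bcontfun v x) (apply_bcontfun w x))"
          by (simp add: dist_real_def abs_mult flip: right_diff_distrib)
        also have "\<dots> \<le> L * (exp (2 * L * x) * ?d)"
          using L by (intro mult_left_mono dist_bounded) auto
        finally show "norm (E v x - E w x) \<le> L * ?d * exp (2 * L * x)" by (simp add: mult_ac)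
      qed
      also have "\<dots> = ?d / 2 * exp (2 * L * ?t) - ?d / 2" using integral_unique[OF ig] by simp
      also have "\<dots> \<le> ?d / 2 * exp (2 * L * ?t)" by simp
      finally have "exp (- (2 * L * ?t)) * \<bar>integral {0..?t} (E v) - integral {0..?t} (E w)\<bar>
          \<le> exp (- (2 * L * ?t)) * (?d / 2 * exp (2 * L * ?t))"
        by (intro mult_left_mono) auto
      also have "\<dots> = 1 / 2 * ?d" by (simp add: exp_minus)
      finally show "dist (apply_bcontfun (G v) t) (apply_bcontfun (G w) t) \<le> 1 / 2 * ?d"
        by (simp add: G F_def dist_real_def abs_mult flip: right_diff_distrib)
    qed
  qed auto
  then obtain v where "G v = v" by blast
  then have v: "apply_bcontfun v t = F v t" for t by (metis G)
  define u where "u t = u0 + integral {0..t} (E v)" for t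
  have Eu: "E v t = g (u t)" if "0 \<le> t" for t
    using that by (simp add: E_def v F_def u_def exp_minus flip: mult.assoc)
  show thesis
  proof (rule that)
    show "u 0 = u0" by (simp add: u_def)
    fix t :: real assume t: "0 \<le> t"
    have "((\<lambda>t. integral {0..t} (E v)) has_real_derivative E v t) (at t within {0..t + 1})"
      using t by (intro integral_has_real_derivative Ec) auto
    moreover have "at t within {0..t + 1} = at t within {0..}"
      using t by (intro at_within_nhd[where S = "{t - 1<..<t + 1}"]) auto
    ultimately show "(u has_real_derivative g (u t)) (at t within {0..})"
      unfolding u_def using Eu[OF t] by (auto intro!: derivative_eq_intros simp: u_def)
  qed
qed

text \<open>A Gronwall bound: the hypothesis makes \<open>u t * exp (L * t)\<close> nondecreasing.
  The sign of \<open>L\<close> is free, so that applying it to a negated function yields upper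
  bounds as well.\<close>

lemma exp_growth_lower_bound:
  fixes u :: "real \<Rightarrow> real"
  assumes "0 \<le> t" and cont: "continuous_on {0..t} u"
    and du: "\<And>s. 0 < s \<Longrightarrow> s < t \<Longrightarrow> \<exists>D. (u has_real_derivative D) (at s) \<and> - (L * u s) \<le> D"
  shows "u 0 \<le> u t * exp (L * t)"
proof -
  have "u 0 * exp (L * 0) \<le> u t * exp (L * t)"
  proof (rule DERIV_nonneg_imp_increasing_open[OF \<open>0 \<le> t\<close>])
    show "continuous_on {0..t} (\<lambda>t. u t * exp (L * t))"
      by (intro continuous_intros cont)
    fix r assume "0 < r" "r < t"
    then obtain D where D: "(u has_real_derivative D) (at r)" "- (L * u r) \<le> D"
      using du by blast
    then have "((\<lambda>t. u t * exp (L * t)) has_real_derivative (D + L * u r) * exp (L * r)) (at r)"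
      by (auto intro!: derivative_eq_intros simp: algebra_simps)
    moreover have "0 \<le> (D + L * u r) * exp (L * r)" using D by simp
    ultimately show "\<exists>y. ((\<lambda>t. u t * exp (L * t)) has_real_derivative y) (at r) \<and> 0 \<le> y" by blast
  qed
  then show ?thesis by simp
qed

text \<open>While \<open>u\<close> is positive it decays at most exponentially, so it cannot arrive
  at zero in finite time. The linear bound on \<open>g\<close> permits an equilibrium at
  \<open>0\<close>.\<close>

lemma ODE_solution_positive:
  fixes u g :: "real \<Rightarrow> real"
  assumes du: "\<And>t. 0 \<le> t \<Longrightarrow> (u has_real_derivative g (u t)) (at t within {0..})"
    and g: "\<And>y. 0 \<le> y \<Longrightarrow> - (L * y) \<le> g y" and u0: "0 < u 0" and t: "0 \<le> t"
  shows "0 < u t"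
proof (rule ccontr)
  assume "\<not> 0 < u t"
  have uc: "continuous_on {0..t} u"
    by (rule continuous_on_subset[of "{0..}"]) (auto intro: DERIV_continuous_on[OF du])
  define Z where "Z = {0..t} \<inter> u -` {..0}"
  have "compact Z" unfolding Z_def
    by (rule compact_eq_bounded_closed[THEN iffD2])
       (auto intro: bounded_subset[of "{0..t}"] continuous_closed_preimage uc)
  moreover have "Z \<noteq> {}" using \<open>\<not> 0 < u t\<close> t by (auto simp: Z_def)
  \<comment> \<open>The earliest time with \<open>u \<le> 0\<close>: before it \<open>u\<close> is
    positive, which is where the bound on \<open>g\<close> applies.\<close>
  ultimately obtain s where s: "s \<in> Z" "\<And>r. r \<in> Z \<Longrightarrow> s \<le> r"
    using compact_attains_inf by metis
  then have s': "0 \<le> s" "s \<le> t" "u s \<le> 0" by (auto simp: Z_def)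
  have pos: "0 < u r" if "0 \<le> r" "r < s" for r
    using s(2)[of r] that s' by (force simp: Z_def)
  have "u 0 \<le> u s * exp (L * s)"
  proof (rule exp_growth_lower_bound[OF \<open>0 \<le> s\<close>])
    show "continuous_on {0..s} u" using s' by (intro continuous_on_subset[OF uc]) auto
    fix r assume r: "0 < r" "r < s"
    then have "(u has_real_derivative g (u r)) (at r)"
      using du[of r] at_within_interior[of r "{0..}"] by simp
    then show "\<exists>D. (u has_real_derivative D) (at r) \<and> - (L * u r) \<le> D"
      using g[of "u r"] pos[of r] r by force
  qed
  moreover have "u s * exp (L * s) \<le> 0" using s'(3) by (simp add: mult_nonpos_nonneg)
  ultimately show False using u0 by linarith
qed

subsection \<open>Uniqueness of vortex solutions\<close>

text \<open>After squaring, both sides expand to the same inner products. As an exact identity it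
  gives a Lipschitz bound for the kernel even when the segment from \<open>u\<close> to
  \<open>v\<close> runs through the singularity at the origin.\<close>

lemma norm_inversion_diff:
  fixes u v :: "'a::real_inner"
  assumes "u \<noteq> 0" "v \<noteq> 0"
  shows "norm (u /\<^sub>R (norm u)\<^sup>2 - v /\<^sub>R (norm v)\<^sup>2) = norm (u - v) / (norm u * norm v)"
proof -
  have "(norm (u /\<^sub>R (norm u)\<^sup>2 - v /\<^sub>R (norm v)\<^sup>2))\<^sup>2
      = (norm (u - v) / (norm u * norm v))\<^sup>2"
    unfolding power_divide power_mult_distrib
    using assms unfolding power2_norm_eq_inner
    by (simp add: inner_diff inner_commute[of v u] divide_simps)
  then show ?thesis by (simp add: power2_eq_iff_nonneg)
qed

lemma at_within_existence_interval:
  assumes "t \<in> existence_interval T" "0 < t"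
  shows "at t within existence_interval T = at t"
proof -
  obtain b where b: "ereal t < ereal b" "ereal b < T"
    using assms ereal_dense2[of "ereal t" T] by (auto simp: existence_interval_def)
  then have "{0<..<b} \<subseteq> existence_interval T"
    by (auto simp: existence_interval_def) (meson ereal_less_eq(3) less_imp_le less_le_trans ereal_less(2) le_less_trans less_trans)
  then show ?thesis
    using assms b by (intro at_within_interior interiorI[of "{0<..<b}"]) auto
qed

lemma Icc_subset_existence_interval:
  "t \<in> existence_interval T \<Longrightarrow> {0..t} \<subseteq> existence_interval T"
  by (auto simp: existence_interval_def) (meson ereal_less_eq(3) le_less_trans)

lemma vortex_solution_continuous_on:
  assumes "vortex_solution N m T x" "j \<in> {1..N}"
  shows "continuous_on (existence_interval T) (x j)"
  using assms unfolding vortex_solution_def continuous_on_eq_continuous_within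
  by (blast intro: has_vector_derivative_continuous)

text \<open>The distance is continuous and positive on the compact interval \<open>{0..t}\<close>.
  The resulting \<open>d\<close> controls the Lipschitz constant of the interaction up to time
  \<open>t\<close>.\<close>

lemma vortex_solution_separated:
  assumes x: "vortex_solution N m T x" and jk: "j \<in> {1..N}" "k \<in> {1..N}" "j \<noteq> k"
    and t: "t \<in> existence_interval T"
  obtains d where "0 < d" "\<And>s. s \<in> {0..t} \<Longrightarrow> d \<le> norm (x j s - x k s)"
proof -
  have "continuous_on {0..t} (\<lambda>s. norm (x j s - x k s))"
    by (intro continuous_intros continuous_on_subset[OF vortex_solution_continuous_on[OF x]]
        Icc_subset_existence_interval t jk)
  moreover have "{0..t} \<noteq> {}" using t by (auto simp: existence_interval_def)
  ultimately obtain s0 where s0: "s0 \<in> {0..t}"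
      "\<And>s. s \<in> {0..t} \<Longrightarrow> norm (x j s0 - x k s0) \<le> norm (x j s - x k s)"
    using continuous_attains_inf[of "{0..t}" "\<lambda>s. norm (x j s - x k s)"] by auto
  moreover have "0 < norm (x j s0 - x k s0)"
    using x jk s0(1) Icc_subset_existence_interval[OF t] unfolding vortex_solution_def by auto
  ultimately show thesis using that by blast
qed

text \<open>The sum \<open>E\<close> of the squared deviations starts at \<open>0\<close> and
  satisfies \<open>E' \<le> B * E\<close>, so it stays \<open>0\<close>. The constant
  \<open>B\<close> belongs to the interval \<open>{0..t}\<close> and to this pair of solutions,
  because the interaction is Lipschitz only away from collisions.\<close>

lemma vortex_solution_unique:
  assumes x: "vortex_solution N m T x" and y: "vortex_solution N m T' y"
    and init: "\<And>j. j \<in> {1..N} \<Longrightarrow> x j 0 = y j 0"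
    and t: "t \<in> existence_interval T" "t \<in> existence_interval T'"
    and i: "i \<in> {1..N}"
  shows "x i t = y i t"
proof -
  define K :: "real ^ 2 \<Rightarrow> real ^ 2" where "K v = v /\<^sub>R (norm v)\<^sup>2" for v
  have "\<exists>C\<ge>0. \<forall>s\<in>{0..t}. norm (K (x j s - x k s) - K (y j s - y k s))
      \<le> C * norm ((x j s - x k s) - (y j s - y k s))"
    if jk: "j \<in> {1..N}" "k \<in> {1..N}" "j \<noteq> k" for j k
  proof -
    obtain d where d: "0 < d" "\<And>s. s \<in> {0..t} \<Longrightarrow> d \<le> norm (x j s - x k s)"
      using vortex_solution_separated[OF x jk t(1)] by blast
    obtain e where e: "0 < e" "\<And>s. s \<in> {0..t} \<Longrightarrow> e \<le> norm (y j s - y k s)"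
      using vortex_solution_separated[OF y jk t(2)] by blast
    have "norm (K (x j s - x k s) - K (y j s - y k s))
        \<le> 1 / (d * e) * norm ((x j s - x k s) - (y j s - y k s))" if s: "s \<in> {0..t}" for s
    proof -
      have de: "d * e \<le> norm (x j s - x k s) * norm (y j s - y k s)"
        using d(1) d(2)[OF s] e(1) e(2)[OF s] by (intro mult_mono) auto
      have nz: "x j s - x k s \<noteq> 0" "y j s - y k s \<noteq> 0" using d(1) d(2)[OF s] e(1) e(2)[OF s] by auto
      then have "norm (K (x j s - x k s) - K (y j s - y k s))
          = norm ((x j s - x k s) - (y j s - y k s)) / (norm (x j s - x k s) * norm (y j s - y k s))"
        unfolding K_def by (rule norm_inversion_diff)
      also have "\<dots> \<le> norm ((x j s - x k s) - (y j s - y k s)) / (d * e)"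
        using de nz d(1) e(1) by (intro divide_left_mono mult_pos_pos) auto
      finally show ?thesis by simp
    qed
    then show ?thesis using d(1) e(1) by (intro exI[of _ "1 / (d * e)"]) auto
  qed
  then obtain C where C0: "\<And>j k. j \<in> {1..N} \<Longrightarrow> k \<in> {1..N} \<Longrightarrow> j \<noteq> k \<Longrightarrow> 0 \<le> C j k"
    and C: "\<And>j k s. j \<in> {1..N} \<Longrightarrow> k \<in> {1..N} \<Longrightarrow> j \<noteq> k \<Longrightarrow> s \<in> {0..t} \<Longrightarrow>
      norm (K (x j s - x k s) - K (y j s - y k s)) \<le> C j k * norm ((x j s - x k s) - (y j s - y k s))"
    by metis
  define w where "w j s = x j s - y j s" for j s
  define E where "E s = (\<Sum>j\<in>{1..N}. w j s \<bullet> w j s)" for s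
  \<comment> \<open>Of the factor \<open>8\<close>, one \<open>2\<close> comes from differentiating
    a square, one from the vortex law and one from \<open>bilinear_bound\<close>.\<close>
  define B where "B = (\<Sum>j\<in>{1..N}. \<Sum>k\<in>{1..N} - {j}. 8 * \<bar>m j\<bar> * \<bar>m k\<bar> * C j k)"
  define w' where "w' j s = (2 * m j) *\<^sub>R (\<Sum>k\<in>{1..N} - {j}.
      m k *\<^sub>R (K (x j s - x k s) - K (y j s - y k s)))" for j s
  have bilinear_bound: "norm (w j s) * norm (w j s - w k s) \<le> 2 * E s" if "j \<in> {1..N}" "k \<in> {1..N}" for j k s
  proof -
    have le: "(norm (w l s))\<^sup>2 \<le> E s" if "l \<in> {1..N}" for l
      unfolding E_def power2_norm_eq_inner using that by (intro member_le_sum) auto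
    have "norm (w j s) * norm (w j s - w k s) \<le> norm (w j s) * (norm (w j s) + norm (w k s))"
      by (intro mult_left_mono norm_triangle_ineq4) auto
    also have "\<dots> \<le> 2 * E s"
      using le[OF that(1)] le[OF that(2)] sum_squares_bound[of "norm (w j s)" "norm (w k s)"]
      by (simp add: power2_eq_square algebra_simps)
    finally show ?thesis .
  qed
  have w'_bound: "(\<Sum>j\<in>{1..N}. 2 * (w j s \<bullet> w' j s)) \<le> B * E s" if s: "s \<in> {0..t}" for s
  proof -
    have "(\<Sum>j\<in>{1..N}. 2 * (w j s \<bullet> w' j s))
        = (\<Sum>j\<in>{1..N}. \<Sum>k\<in>{1..N} - {j}. 4 * m j * m k * (w j s \<bullet> (K (x j s - x k s) - K (y j s - y k s))))"
      by (simp add: w'_def inner_sum_right sum_distrib_left mult_ac)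
    also have "\<dots> \<le> (\<Sum>j\<in>{1..N}. \<Sum>k\<in>{1..N} - {j}. 8 * \<bar>m j\<bar> * \<bar>m k\<bar> * C j k * E s)"
    proof (intro sum_mono)
      fix j k assume j: "j \<in> {1..N}" and k: "k \<in> {1..N} - {j}"
      then have jk: "j \<in> {1..N}" "k \<in> {1..N}" "j \<noteq> k" by auto
      let ?D = "K (x j s - x k s) - K (y j s - y k s)"
      have "4 * m j * m k * (w j s \<bullet> ?D) \<le> \<bar>4 * m j * m k * (w j s \<bullet> ?D)\<bar>" by simp
      also have "\<dots> = 4 * \<bar>m j\<bar> * \<bar>m k\<bar> * \<bar>w j s \<bullet> ?D\<bar>" by (simp add: abs_mult)
      also have "\<dots> \<le> 4 * \<bar>m j\<bar> * \<bar>m k\<bar> * (norm (w j s) * norm ?D)"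
        by (intro mult_left_mono Cauchy_Schwarz_ineq2) auto
      also have "\<dots> \<le> 4 * \<bar>m j\<bar> * \<bar>m k\<bar> * (norm (w j s) * (C j k * norm (w j s - w k s)))"
        using C[OF jk s] by (intro mult_left_mono) (auto simp: w_def algebra_simps)
      also have "\<dots> = 4 * \<bar>m j\<bar> * \<bar>m k\<bar> * C j k * (norm (w j s) * norm (w j s - w k s))" by simp
      also have "\<dots> \<le> 4 * \<bar>m j\<bar> * \<bar>m k\<bar> * C j k * (2 * E s)"
        using C0[OF jk] bilinear_bound[OF jk(1,2)] by (intro mult_left_mono) auto
      finally show "4 * m j * m k * (w j s \<bullet> ?D) \<le> 8 * \<bar>m j\<bar> * \<bar>m k\<bar> * C j k * E s" by simp
    qed
    also have "\<dots> = B * E s" by (simp add: B_def sum_distrib_right)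
    finally show ?thesis .
  qed
  have t0: "0 \<le> t" using t by (simp add: existence_interval_def)
  \<comment> \<open>The growth lemma bounds from below; with \<open>- E\<close> and the rate
    \<open>- B\<close> it bounds \<open>E\<close> from above.\<close>
  have "- E 0 \<le> - E t * exp (- B * t)"
  proof (rule exp_growth_lower_bound[OF t0])
    show "continuous_on {0..t} (\<lambda>s. - E s)"
      unfolding E_def w_def
      by (intro continuous_intros continuous_on_subset[OF vortex_solution_continuous_on[OF x]]
          continuous_on_subset[OF vortex_solution_continuous_on[OF y]] Icc_subset_existence_interval t) auto
    fix s assume s: "0 < s" "s < t"
    then have sT: "s \<in> existence_interval T" "s \<in> existence_interval T'"
      using t Icc_subset_existence_interval by fastforce+
    have dw: "(w j has_vector_derivative w' j s) (at s)" if "j \<in> {1..N}" for j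
    proof -
      have "w' j s = (2 * m j) *\<^sub>R (\<Sum>k\<in>{1..N} - {j}. m k *\<^sub>R K (x j s - x k s))
          - (2 * m j) *\<^sub>R (\<Sum>k\<in>{1..N} - {j}. m k *\<^sub>R K (y j s - y k s))"
        by (simp add: w'_def scaleR_diff_right sum_subtractf)
      moreover have "(x j has_vector_derivative
          (2 * m j) *\<^sub>R (\<Sum>k\<in>{1..N} - {j}. m k *\<^sub>R K (x j s - x k s))) (at s)"
        "(y j has_vector_derivative
          (2 * m j) *\<^sub>R (\<Sum>k\<in>{1..N} - {j}. m k *\<^sub>R K (y j s - y k s))) (at s)"
        using x y sT that s at_within_existence_interval[OF sT(1)] at_within_existence_interval[OF sT(2)]
        unfolding vortex_solution_def K_def by force+
      ultimately show ?thesis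
        unfolding w_def by (simp add: has_vector_derivative_diff)
    qed
    have "((\<lambda>s. w j s \<bullet> w j s) has_real_derivative 2 * (w j s \<bullet> w' j s)) (at s)"
      if "j \<in> {1..N}" for j
      using has_derivative_inner[OF dw[OF that, unfolded has_vector_derivative_def]
          dw[OF that, unfolded has_vector_derivative_def]]
      unfolding has_field_derivative_def
      by (rule has_derivative_eq_rhs) (auto simp: fun_eq_iff inner_commute algebra_simps)
    then have "((\<lambda>s. - E s) has_real_derivative - (\<Sum>j\<in>{1..N}. 2 * (w j s \<bullet> w' j s))) (at s)"
      unfolding E_def by (intro DERIV_minus DERIV_sum) auto
    then show "\<exists>D. ((\<lambda>s. - E s) has_real_derivative D) (at s) \<and> - (- B * - E s) \<le> D"
      using w'_bound[of s] s by force
  qed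
  moreover have "E 0 = 0" using init by (simp add: E_def w_def)
  ultimately have "E t \<le> 0" by (simp add: mult_le_0_iff)
  then have "(\<Sum>j\<in>{1..N}. w j t \<bullet> w j t) = 0"
    unfolding E_def by (intro antisym sum_nonneg) auto
  then have "w i t \<bullet> w i t = 0"
    using i by (subst (asm) sum_nonneg_eq_0_iff) auto
  then show ?thesis by (simp add: w_def)
qed

subsection \<open>The squared radii for at least three vortices per ring\<close>

text \<open>Meant for \<open>a = sqrt s\<close> and \<open>b = sqrt t\<close>: it makes
  \<open>sqrt s ^ n\<close> Lipschitz in \<open>s\<close> up to \<open>s = 0\<close>, where the root
  alone is not. The induction splits off \<open>a * (a ^ n - b ^ n)\<close> and
  \<open>b ^ n * (a - b)\<close>.\<close>

lemma power_diff_le_square_diff: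
  fixes a b :: real
  assumes "0 \<le> b" "b \<le> a" "a \<le> 1" "2 \<le> n"
  shows "a ^ n - b ^ n \<le> real n * (a\<^sup>2 - b\<^sup>2)"
  using \<open>2 \<le> n\<close>
proof (induction n rule: dec_induct)
  case base
  have "b\<^sup>2 \<le> a\<^sup>2" using assms by (intro power_mono) auto
  then show ?case by simp
next
  case (step n)
  have "a ^ n - b ^ n \<ge> 0" using assms by (simp add: power_mono)
  then have "a * (a ^ n - b ^ n) \<le> 1 * (a ^ n - b ^ n)" using assms by (intro mult_right_mono) auto
  moreover have "b ^ n * (a - b) \<le> (a + b) * (a - b)"
  proof (rule mult_right_mono)
    have "b ^ n \<le> b ^ 1" using assms step by (intro power_decreasing) auto
    then show "b ^ n \<le> a + b" using assms by simp
  qed (use assms in simp)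
  ultimately show ?case
    using step.IH by (simp add: algebra_simps power2_eq_square)
qed

text \<open>The quotient \<open>r1 ^ n / (r1 ^ n + r2 ^ n)\<close> from
  \<open>config_interaction\<close>, written in terms of
  \<open>s = r1\<^sup>2 / (r1\<^sup>2 + r2\<^sup>2)\<close>. It is homogeneous of degree zero in the
  radii, so the total size drops out.\<close>

definition share :: "nat \<Rightarrow> real \<Rightarrow> real" where
  "share n s = sqrt s ^ n / (sqrt s ^ n + sqrt (1 - s) ^ n)"

lemma sqrt_power_lipschitz:
  assumes "s \<in> {0..1}" "t \<in> {0..1}" "2 \<le> n"
  shows "\<bar>sqrt s ^ n - sqrt t ^ n\<bar> \<le> real n * \<bar>s - t\<bar>"
proof -
  have *: "sqrt s ^ n - sqrt t ^ n \<le> real n * (s - t)" if "0 \<le> t" "t \<le> s" "s \<le> 1" for s t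
    using power_diff_le_square_diff[of "sqrt t" "sqrt s" n] that assms(3) by simp
  show ?thesis
  proof (cases "t \<le> s")
    case True
    then have "sqrt t ^ n \<le> sqrt s ^ n" using assms by (intro power_mono) auto
    then show ?thesis using *[of t s] True assms by auto
  next
    case False
    then have "sqrt s ^ n \<le> sqrt t ^ n" using assms by (intro power_mono) auto
    then show ?thesis using *[of s t] False assms by auto
  qed
qed

text \<open>One of \<open>s\<close> and \<open>1 - s\<close> is at least \<open>1 / 2\<close>; this
  keeps the denominator of \<open>share\<close> away from zero uniformly in
  \<open>s\<close>.\<close>

lemma share_denominator:
  assumes "s \<in> {0..1}"
  shows "sqrt (1 / 2) ^ n \<le> sqrt s ^ n + sqrt (1 - s) ^ n"
proof (cases "1 / 2 \<le> s")
  case True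
  then have "sqrt (1 / 2) ^ n \<le> sqrt s ^ n" by (intro power_mono) auto
  then show ?thesis using assms by (simp add: add_increasing2)
next
  case False
  then have "sqrt (1 / 2) ^ n \<le> sqrt (1 - s) ^ n" by (intro power_mono) auto
  then show ?thesis using assms by (simp add: add_increasing)
qed

lemma share_denominator_pos: "s \<in> {0..1} \<Longrightarrow> 0 < sqrt s ^ n + sqrt (1 - s) ^ n"
  using share_denominator[of s n] less_le_trans[of 0 "sqrt (1 / 2) ^ n"] by simp

lemma share_bounds:
  assumes "s \<in> {0..1}"
  shows "0 \<le> share n s" "share n s \<le> 1"
  using assms share_denominator_pos[OF assms, of n] by (auto simp: share_def)

lemma share_lipschitz:
  assumes "2 \<le> n"
  obtains L where "0 \<le> L"
    "\<And>s t. s \<in> {0..1} \<Longrightarrow> t \<in> {0..1} \<Longrightarrow> \<bar>share n s - share n t\<bar> \<le> L * \<bar>s - t\<bar>"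
proof
  let ?c = "sqrt (1 / 2) ^ n"
  show "0 \<le> 2 * real n / (?c * ?c)" by simp
  fix s t :: real assume s: "s \<in> {0..1}" and t: "t \<in> {0..1}"
  define a a' b b' where "a = sqrt s ^ n" and "a' = sqrt (1 - s) ^ n"
    and "b = sqrt t ^ n" and "b' = sqrt (1 - t) ^ n"
  have c: "0 < ?c" by simp
  have D: "?c \<le> a + a'" "?c \<le> b + b'"
    using share_denominator[OF s] share_denominator[OF t] by (simp_all add: a_def a'_def b_def b'_def)
  have ab: "0 \<le> a" "a \<le> 1" "0 \<le> a'" "a' \<le> 1"
    using s by (auto simp: a_def a'_def intro!: power_le_one)
  have d: "\<bar>a - b\<bar> \<le> real n * \<bar>s - t\<bar>" "\<bar>b' - a'\<bar> \<le> real n * \<bar>s - t\<bar>"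
    using sqrt_power_lipschitz[OF s t assms] sqrt_power_lipschitz[of "1 - t" "1 - s" n] s t assms
    by (auto simp: a_def a'_def b_def b'_def)
  \<comment> \<open>The numerator is \<open>a * b' - a' * b\<close> with \<open>a * a'\<close>
    subtracted and added, so that only differences controlled by \<open>d\<close> appear.\<close>
  have "share n s - share n t = (a * (b' - a') + a' * (a - b)) / ((a + a') * (b + b'))"
    unfolding share_def a_def[symmetric] a'_def[symmetric] b_def[symmetric] b'_def[symmetric]
    using less_le_trans[OF c D(1)] less_le_trans[OF c D(2)]
    by (simp add: diff_frac_eq algebra_simps)
  then have "\<bar>share n s - share n t\<bar> = \<bar>a * (b' - a') + a' * (a - b)\<bar> / ((a + a') * (b + b'))"
    using less_le_trans[OF c D(1)] less_le_trans[OF c D(2)] by (simp add: abs_mult)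
  also have "\<dots> \<le> (2 * real n * \<bar>s - t\<bar>) / (?c * ?c)"
  proof (rule frac_le)
    have "\<bar>a * (b' - a') + a' * (a - b)\<bar> \<le> a * \<bar>b' - a'\<bar> + a' * \<bar>a - b\<bar>"
      using abs_triangle_ineq[of "a * (b' - a')" "a' * (a - b)"] ab by (simp add: abs_mult)
    also have "\<dots> \<le> 1 * (real n * \<bar>s - t\<bar>) + 1 * (real n * \<bar>s - t\<bar>)"
      using ab d by (intro add_mono mult_mono) auto
    finally show "\<bar>a * (b' - a') + a' * (a - b)\<bar> \<le> 2 * real n * \<bar>s - t\<bar>" by simp
    show "?c * ?c \<le> (a + a') * (b + b')" using D c ab by (intro mult_mono) linarith+
  qed (use c ab in auto)
  finally show "\<bar>share n s - share n t\<bar> \<le> 2 * real n / (?c * ?c) * \<bar>s - t\<bar>" by simp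
qed

lemma share_of_scaled:
  assumes "0 < S"
  shows "share n s = sqrt (s * S) ^ n / (sqrt (s * S) ^ n + sqrt ((1 - s) * S) ^ n)"
  using assms by (simp add: share_def real_sqrt_mult power_mult_distrib flip: distrib_right)

text \<open>
  In the time \<open>\<tau> = ln (S 0 / S t) / 4\<close>, where \<open>S t = \<rho>1 t + \<rho>2 t\<close>, the fraction
  \<open>s = \<rho>1 / S\<close> satisfies an autonomous scalar equation.
\<close>

lemma radii_exist:
  assumes n: "3 \<le> n" and R: "0 < R1" "0 < R2"
  obtains \<rho>1 \<rho>2 :: "real \<Rightarrow> real" where
    "\<rho>1 0 = R1" "\<rho>2 0 = R2"
    "\<And>t. t \<in> {0..<(R1 + R2) / 4} \<Longrightarrow> 0 < \<rho>1 t \<and> 0 < \<rho>2 t \<and> \<rho>1 t + \<rho>2 t = R1 + R2 - 4 * t"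
    "\<And>t. t \<in> {0..<(R1 + R2) / 4} \<Longrightarrow>
      (\<rho>1 has_real_derivative
        2 * (real n - 3) - 4 * real n * (sqrt (\<rho>1 t) ^ n / (sqrt (\<rho>1 t) ^ n + sqrt (\<rho>2 t) ^ n)))
      (at t within {0..<(R1 + R2) / 4})"
    "\<And>t. t \<in> {0..<(R1 + R2) / 4} \<Longrightarrow>
      (\<rho>2 has_real_derivative
        2 * (real n + 1) - 4 * real n * (sqrt (\<rho>2 t) ^ n / (sqrt (\<rho>1 t) ^ n + sqrt (\<rho>2 t) ^ n)))
      (at t within {0..<(R1 + R2) / 4})"
proof -
  \<comment> \<open>Clamping to \<open>[0, 1]\<close> turns \<open>f\<close> into a bounded,
    globally Lipschitz rate; the solution later proves to stay in the interval, where the clamp is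
    the identity.\<close>
  let ?c = "\<lambda>y :: real. max 0 (min 1 y)"
  \<comment> \<open>With \<open>S' = -4\<close>, differentiating \<open>s = \<rho>1 / S\<close>
    gives \<open>S * s' = \<rho>1' + 4 * s\<close>.\<close>
  define f where "f s = 2 * (real n - 3) - 4 * real n * share n s + 4 * s" for s
  define g where "g y = f (?c y)" for y
  obtain L where L: "0 \<le> L"
    "\<And>s t. s \<in> {0..1} \<Longrightarrow> t \<in> {0..1} \<Longrightarrow> \<bar>share n s - share n t\<bar> \<le> L * \<bar>s - t\<bar>"
    using share_lipschitz[of n] n by auto
  define K where "K = 4 * real n * L + 4"
  have K: "0 < K" using L(1) by (simp add: K_def add_nonneg_pos)
  have lip: "\<bar>g y - g z\<bar> \<le> K * \<bar>y - z\<bar>" for y z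
  proof -
    have "\<bar>g y - g z\<bar> \<le> 4 * real n * \<bar>share n (?c y) - share n (?c z)\<bar> + 4 * \<bar>?c y - ?c z\<bar>"
    proof -
      have "g y - g z = 4 * (?c y - ?c z) - 4 * real n * (share n (?c y) - share n (?c z))"
        by (simp add: g_def f_def algebra_simps)
      then have "\<bar>g y - g z\<bar>
          \<le> \<bar>4 * (?c y - ?c z)\<bar> + \<bar>4 * real n * (share n (?c y) - share n (?c z))\<bar>"
        by (simp only: abs_triangle_ineq4)
      then show ?thesis by (simp only: abs_mult abs_numeral abs_of_nat add.commute)
    qed
    also have "\<dots> \<le> 4 * real n * (L * \<bar>?c y - ?c z\<bar>) + 4 * \<bar>?c y - ?c z\<bar>"
      by (intro add_mono mult_left_mono L) auto
    also have "\<dots> = K * \<bar>?c y - ?c z\<bar>" by (simp add: K_def algebra_simps)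
    also have "\<dots> \<le> K * \<bar>y - z\<bar>" using K by (intro mult_left_mono) auto
    finally show ?thesis .
  qed
  have bd: "\<bar>g y\<bar> \<le> 6 * real n + 4" for y
  proof -
    have "0 \<le> 4 * real n * share n (?c y)" "4 * real n * share n (?c y) \<le> 4 * real n * 1"
      using share_bounds[of "?c y" n] by (simp, intro mult_left_mono) auto
    moreover have "0 \<le> ?c y" "?c y \<le> 1" by auto
    moreover have "3 \<le> real n" using n by simp
    moreover have "\<bar>2 * (r - 3) - p + 4 * q\<bar> \<le> 6 * r + 4"
      if "0 \<le> p" "p \<le> 4 * r * 1" "0 \<le> q" "q \<le> 1" "3 \<le> r" for p q r :: real
      using that by (simp add: abs_le_iff)
    ultimately show ?thesis unfolding g_def f_def by blast
  qed
  obtain u where u0: "u 0 = R1 / (R1 + R2)"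
    and du: "\<And>t. 0 \<le> t \<Longrightarrow> (u has_real_derivative g (u t)) (at t within {0..})"
    using global_ODE_solution[OF lip bd K] by blast
  have u_pos: "0 < u t" if "0 \<le> t" for t
  proof (rule ODE_solution_positive[OF du _ _ that])
    show "0 < u 0" using R by (simp add: u0)
    fix y :: real assume "0 \<le> y"
    \<comment> \<open>Here \<open>g 0 = 2 * (n - 3)\<close>, so this is the step that separates
      \<open>n \<ge> 3\<close> from \<open>n = 2\<close>.\<close>
    moreover have "0 \<le> g 0" using n by (simp add: g_def f_def share_def power_0_left)
    ultimately show "- (K * y) \<le> g y" using lip[of y 0] by simp
  qed auto
  have u_less: "0 < 1 - u t" if "0 \<le> t" for t
  proof (rule ODE_solution_positive[where u = "\<lambda>t. 1 - u t" and g = "\<lambda>y. - g (1 - y)", OF _ _ _ that])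
    show "((\<lambda>t. 1 - u t) has_real_derivative - g (1 - (1 - u t))) (at t within {0..})" if "0 \<le> t" for t
      using du[OF that] by (auto intro!: derivative_eq_intros)
    show "0 < 1 - u 0" using R by (simp add: u0 field_simps)
    fix y :: real assume "0 \<le> y"
    \<comment> \<open>The value is \<open>- 2 * (n + 1)\<close>: at this end all of the share
      belongs to the inner ring.\<close>
    moreover have "g 1 \<le> 0" using n by (simp add: g_def f_def share_def power_0_left)
    ultimately show "- (K * y) \<le> - g (1 - y)" using lip[of "1 - y" 1] by simp
  qed
  have u01: "u t \<in> {0..1}" if "0 \<le> t" for t using u_pos[OF that] u_less[OF that] by simp
  have gu: "g (u t) = f (u t)" if "0 \<le> t" for t using u01[OF that] by (simp add: g_def)
  define S where "S t = R1 + R2 - 4 * t" for t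
  define J where "J = {0..<(R1 + R2) / 4}"
  define \<tau> where "\<tau> t = ln ((R1 + R2) / S t) / 4" for t
  define \<rho>1 where "\<rho>1 t = u (\<tau> t) * S t" for t
  define \<rho>2 where "\<rho>2 t = (1 - u (\<tau> t)) * S t" for t
  have S: "0 < S t" "S t \<le> R1 + R2" if "t \<in> J" for t using that by (auto simp: S_def J_def)
  have \<tau>0: "0 \<le> \<tau> t" if "t \<in> J" for t using S[OF that] by (simp add: \<tau>_def)
  have d\<tau>: "(\<tau> has_real_derivative 1 / S t) (at t within J)" if "t \<in> J" for t
    using S[OF that] R unfolding \<tau>_def S_def
    by (auto intro!: derivative_eq_intros simp: divide_simps power2_eq_square)
  have du\<tau>: "((\<lambda>t. u (\<tau> t)) has_real_derivative f (u (\<tau> t)) / S t) (at t within J)" if "t \<in> J" for t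
  proof -
    have "(u has_real_derivative g (u (\<tau> t))) (at (\<tau> t) within \<tau> ` J)"
      by (rule DERIV_subset[OF du[OF \<tau>0[OF that]]]) (use \<tau>0 in auto)
    from DERIV_image_chain[OF this d\<tau>[OF that]] show ?thesis
      using gu[OF \<tau>0[OF that]] by (simp add: o_def)
  qed
  have d1: "(\<rho>1 has_real_derivative f (u (\<tau> t)) - 4 * u (\<tau> t)) (at t within J)" if "t \<in> J" for t
  proof -
    have "(S has_real_derivative - 4) (at t within J)"
      unfolding S_def by (auto intro!: derivative_eq_intros)
    from DERIV_mult[OF du\<tau>[OF that] this] show ?thesis
      unfolding \<rho>1_def[abs_def] by (rule DERIV_cong) (use S(1)[OF that] in simp)
  qed
  \<comment> \<open>Obtained from \<open>\<rho>2 = S - \<rho>1\<close>; the symmetric form of the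
    equation follows later because the two shares add up to \<open>1\<close>.\<close>
  have d2: "(\<rho>2 has_real_derivative - 4 - (f (u (\<tau> t)) - 4 * u (\<tau> t))) (at t within J)" if "t \<in> J" for t
  proof -
    have "\<rho>2 = (\<lambda>t. S t - \<rho>1 t)" by (auto simp: \<rho>1_def \<rho>2_def algebra_simps)
    then show ?thesis using d1[OF that] unfolding S_def by (auto intro!: derivative_eq_intros)
  qed
  have sh1: "share n (u (\<tau> t)) = sqrt (\<rho>1 t) ^ n / (sqrt (\<rho>1 t) ^ n + sqrt (\<rho>2 t) ^ n)" if "t \<in> J" for t
    unfolding \<rho>1_def \<rho>2_def by (rule share_of_scaled[OF S(1)[OF that]])
  have sh2: "1 - share n (u (\<tau> t)) = sqrt (\<rho>2 t) ^ n / (sqrt (\<rho>1 t) ^ n + sqrt (\<rho>2 t) ^ n)" if "t \<in> J" for t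
  proof -
    have "0 < \<rho>1 t" "0 < \<rho>2 t"
      using u_pos[OF \<tau>0[OF that]] u_less[OF \<tau>0[OF that]] S[OF that] by (auto simp: \<rho>1_def \<rho>2_def)
    then have "0 < sqrt (\<rho>1 t) ^ n + sqrt (\<rho>2 t) ^ n" by (intro add_pos_pos) auto
    then show ?thesis unfolding sh1[OF that] by (simp add: field_simps)
  qed
  show thesis
  proof (rule that[of \<rho>1 \<rho>2, folded J_def])
    show "\<rho>1 0 = R1" "\<rho>2 0 = R2"
      using R by (simp_all add: \<rho>1_def \<rho>2_def \<tau>_def S_def u0 field_simps)
    fix t assume t: "t \<in> J"
    show "0 < \<rho>1 t \<and> 0 < \<rho>2 t \<and> \<rho>1 t + \<rho>2 t = R1 + R2 - 4 * t"
      using u_pos[OF \<tau>0[OF t]] u_less[OF \<tau>0[OF t]] S[OF t]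
      by (simp add: \<rho>1_def \<rho>2_def) (simp add: S_def algebra_simps)
    show "(\<rho>1 has_real_derivative
        2 * (real n - 3) - 4 * real n * (sqrt (\<rho>1 t) ^ n / (sqrt (\<rho>1 t) ^ n + sqrt (\<rho>2 t) ^ n)))
        (at t within J)"
      using d1[OF t] unfolding sh1[OF t, symmetric] by (simp add: f_def)
    have "- 4 - (f (u (\<tau> t)) - 4 * u (\<tau> t)) = 2 * (real n + 1) - 4 * real n * (1 - share n (u (\<tau> t)))"
      by (simp add: f_def algebra_simps)
    from DERIV_cong[OF d2[OF t] this]
    show "(\<rho>2 has_real_derivative
        2 * (real n + 1) - 4 * real n * (sqrt (\<rho>2 t) ^ n / (sqrt (\<rho>1 t) ^ n + sqrt (\<rho>2 t) ^ n)))
        (at t within J)"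
      unfolding sh2[OF t] .
  qed
qed

subsection \<open>Reduction to the radii and collisions\<close>

text \<open>A vortex at \<open>z\<close> with velocity \<open>2 * cnj (c / z)\<close> moves radially
  with \<open>r' = 2 * c / r\<close>, that is \<open>(r\<^sup>2)' = 4 * c\<close>. Squared radii
  thus remove the denominator.\<close>

lemma radial_vector_derivative:
  assumes d: "(\<rho> has_real_derivative 4 * c) (at t within J)" and pos: "0 < \<rho> t"
  shows "((\<lambda>t. sqrt (\<rho> t) *\<^sub>R direction \<phi>) has_vector_derivative
    vec_of_complex (2 * cnj (of_real c * inverse (of_real (sqrt (\<rho> t)) * cis \<phi>)))) (at t within J)"
proof -
  have "((\<lambda>t. sqrt (\<rho> t)) has_real_derivative (inverse (sqrt (\<rho> t)) / 2) * (4 * c)) (at t within J)"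
    by (rule DERIV_chain2[OF DERIV_real_sqrt[OF pos] d])
  then have "((\<lambda>t. sqrt (\<rho> t) *\<^sub>R vec_of_complex (cis \<phi>)) has_vector_derivative
      ((inverse (sqrt (\<rho> t)) / 2) * (4 * c)) *\<^sub>R vec_of_complex (cis \<phi>)) (at t within J)"
    unfolding has_real_derivative_iff_has_vector_derivative
    by (rule bounded_linear.has_vector_derivative[OF bounded_linear_scaleR_left])
  moreover have "2 * cnj (of_real c * inverse (of_real (sqrt (\<rho> t)) * cis \<phi>))
      = of_real ((inverse (sqrt (\<rho> t)) / 2) * (4 * c)) * cis \<phi>"
    by (simp add: cis_cnj cis_inverse)
  ultimately show ?thesis
    by (simp only: vec_of_complex_simps direction_eq_vec_of_complex)
qed

section \<open>Collision clusters of arbitrary vortex solutions\<close>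

lemma vortex_solution_distinct:
  assumes "vortex_solution N m T x" "t \<in> existence_interval T" "j \<in> {1..N}" "k \<in> {1..N}" "j \<noteq> k"
  shows "x j t \<noteq> x k t"
  using assms by (simp add: vortex_solution_def)

lemma vortex_solution_tendsto_at_left:
  assumes "vortex_solution N m T x" "j \<in> {1..N}" "0 < t" "t \<in> existence_interval T"
  shows "(x j \<longlongrightarrow> x j t) (at_left t)"
proof -
  have "continuous (at t within existence_interval T) (x j)"
    using vortex_solution_continuous_on[OF assms(1,2)] assms(4)
    by (simp add: continuous_on_eq_continuous_within)
  then have "(x j \<longlongrightarrow> x j t) (at t)"
    unfolding at_within_existence_interval[OF assms(4,3)] continuous_at .
  then show ?thesis by (rule tendsto_within_subset) simp
qed

lemma vortex_solution_Min_dist_pos: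
  assumes x: "vortex_solution N m T x" and t: "t \<in> existence_interval T" and N: "2 \<le> N"
  shows "0 < Min {dist (x j t) (x l t) | j l. 1 \<le> j \<and> j < l \<and> l \<le> N}"
proof (subst Min_gr_iff)
  have "{dist (x j t) (x l t) | j l. 1 \<le> j \<and> j < l \<and> l \<le> N}
      \<subseteq> (\<lambda>(j, l). dist (x j t) (x l t)) ` ({1..N} \<times> {1..N})" by force
  then show "finite {dist (x j t) (x l t) | j l. 1 \<le> j \<and> j < l \<and> l \<le> N}"
    by (rule finite_subset) auto
  have "dist (x 1 t) (x 2 t) \<in> {dist (x j t) (x l t) | j l. 1 \<le> j \<and> j < l \<and> l \<le> N}"
    using N by force
  then show "{dist (x j t) (x l t) | j l. 1 \<le> j \<and> j < l \<and> l \<le> N} \<noteq> {}" by blast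
  show "\<forall>a\<in>{dist (x j t) (x l t) | j l. 1 \<le> j \<and> j < l \<and> l \<le> N}. 0 < a"
    using x t unfolding vortex_solution_def by auto
qed

lemma existence_interval_ereal: "existence_interval (ereal T) = {0..<T}"
  by (auto simp: existence_interval_def)

lemma cluster_obtain_pair:
  assumes "cluster_collides_at N T x I Tc p"
  obtains j k where "j \<in> I" "k \<in> I" "j \<noteq> k" "j \<in> {1..N}" "k \<in> {1..N}"
    "(x j \<longlongrightarrow> p) (at_left Tc)" "(x k \<longlongrightarrow> p) (at_left Tc)"
proof -
  have I: "I \<subseteq> {1..N}" "2 \<le> card I" "\<And>j. j \<in> I \<Longrightarrow> (x j \<longlongrightarrow> p) (at_left Tc)"
    using assms by (auto simp: cluster_collides_at_def)
  have "finite I" using I(1) by (rule finite_subset) simp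
  moreover have "\<not> card I \<le> Suc 0" using I(2) by simp
  ultimately obtain j k where "j \<in> I" "k \<in> I" "j \<noteq> k"
    using card_le_Suc0_iff_eq[of I] by blast
  then show thesis using I by (intro that[of j k]) auto
qed

text \<open>If the solution survived past \<open>Tc\<close>, continuity would place two members of
  the cluster at the same point at time \<open>Tc\<close>.\<close>

lemma cluster_collision_time:
  assumes x: "vortex_solution N m T x" and c: "cluster_collides_at N T x I Tc p"
  shows "T = ereal Tc"
proof (rule ccontr)
  assume "T \<noteq> ereal Tc"
  with c have T: "0 < Tc" "ereal Tc < T" by (auto simp: cluster_collides_at_def)
  then have Tc: "Tc \<in> existence_interval T" by (simp add: existence_interval_def)
  obtain j k where "j \<in> I" "k \<in> I" and jk: "j \<noteq> k" "j \<in> {1..N}" "k \<in> {1..N}"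
    "(x j \<longlongrightarrow> p) (at_left Tc)" "(x k \<longlongrightarrow> p) (at_left Tc)"
    by (rule cluster_obtain_pair[OF c])
  have "x i Tc = p" if "i \<in> {1..N}" "(x i \<longlongrightarrow> p) (at_left Tc)" for i
    using vortex_solution_tendsto_at_left[OF x that(1) T(1) Tc] that(2)
    by (rule tendsto_unique[OF trivial_limit_at_left_real])
  then have "x j Tc = p" "x k Tc = p" using jk by blast+
  then show False using vortex_solution_distinct[OF x Tc jk(2,3,1)] by simp
qed

text \<open>Once all limits at \<open>Tc\<close> are known, a cluster is determined by its collision
  point: an outside vortex with the same limit would force the limiting distance
  \<open>d > 0\<close> down to \<open>0\<close>.\<close>

lemma cluster_eq_limit_fibre:
  assumes c: "cluster_collides_at N T x I Tc p"
    and lim: "\<And>j. j \<in> {1..N} \<Longrightarrow> (x j \<longlongrightarrow> L j) (at_left Tc)"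
  shows "I = {j \<in> {1..N}. L j = p}"
proof -
  have I: "I \<subseteq> {1..N}" "\<And>j. j \<in> I \<Longrightarrow> (x j \<longlongrightarrow> p) (at_left Tc)"
    and out: "\<And>l. l \<in> {1..N} - I \<Longrightarrow>
      \<exists>d>0. ((\<lambda>t. Min ((\<lambda>j. dist (x j t) (x l t)) ` I)) \<longlongrightarrow> d) (at_left Tc)"
    using c by (auto simp: cluster_collides_at_def)
  have "L j = p" if "j \<in> I" for j
    using tendsto_unique[OF trivial_limit_at_left_real lim I(2)] that I(1) by auto
  moreover have "L l \<noteq> p" if l: "l \<in> {1..N} - I" for l
  proof
    assume "L l = p"
    obtain d where d: "0 < d" "((\<lambda>t. Min ((\<lambda>j. dist (x j t) (x l t)) ` I)) \<longlongrightarrow> d) (at_left Tc)"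
      using out[OF l] by blast
    obtain j where j: "j \<in> I" by (rule cluster_obtain_pair[OF c])
    have "((\<lambda>t. dist (x j t) (x l t)) \<longlongrightarrow> dist p p) (at_left Tc)"
      using I(2)[OF j] lim[of l] l \<open>L l = p\<close> by (intro tendsto_dist) auto
    moreover have "Min ((\<lambda>j. dist (x j t) (x l t)) ` I) \<le> dist (x j t) (x l t)" for t
      using j finite_subset[OF I(1)] by (intro Min_le) auto
    ultimately have "d \<le> dist p p"
      by (intro tendsto_le[OF trivial_limit_at_left_real _ d(2)] always_eventually allI)
    then show False using d(1) by simp
  qed
  ultimately show ?thesis using I(1) by blast
qed

section \<open>Ring motions as solutions of the vortex system\<close>

context two_rings begin

definition motion :: "(real \<Rightarrow> real) \<Rightarrow> (real \<Rightarrow> real) \<Rightarrow> nat \<Rightarrow> real \<Rightarrow> real ^ 2" where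
  "motion \<rho>1 \<rho>2 j t = vec_of_complex (config (sqrt (\<rho>1 t)) (sqrt (\<rho>2 t)) j)"

lemma motion_simps:
  "j \<in> {1..n} \<Longrightarrow> motion \<rho>1 \<rho>2 j = (\<lambda>t. sqrt (\<rho>1 t) *\<^sub>R direction (\<theta> j))"
  "j \<in> {1..n} \<Longrightarrow> motion \<rho>1 \<rho>2 (n + j) = (\<lambda>t. sqrt (\<rho>2 t) *\<^sub>R direction (\<alpha> j))"
  "motion \<rho>1 \<rho>2 N = (\<lambda>t. 0)"
  by (simp_all add: motion_def[abs_def] config_simps direction_eq_vec_of_complex)

lemma motion_tendsto:
  assumes "(\<rho>1 \<longlongrightarrow> R1) F" "(\<rho>2 \<longlongrightarrow> R2) F" "j \<in> {1..N}"
  shows "(motion \<rho>1 \<rho>2 j \<longlongrightarrow> vec_of_complex (config (sqrt R1) (sqrt R2) j)) F"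
  using assms(3)
proof (cases rule: index_cases)
  case inner
  then show ?thesis
    using assms(1) by (auto simp: motion_simps config_simps direction_eq_vec_of_complex intro!: tendsto_intros)
next
  case (outer i)
  then show ?thesis
    using assms(2) by (auto simp: motion_simps config_simps direction_eq_vec_of_complex intro!: tendsto_intros)
next
  case centre
  then show ?thesis by (simp add: motion_simps config_simps)
qed

text \<open>The right-hand sides are \<open>4\<close> times the real coefficients in
  \<open>config_interaction\<close>, the factor supplied by
  \<open>radial_vector_derivative\<close>.\<close>

definition radii :: "(real \<Rightarrow> real) \<Rightarrow> (real \<Rightarrow> real) \<Rightarrow> real set \<Rightarrow> bool" where
  "radii \<rho>1 \<rho>2 J \<longleftrightarrow> (\<forall>t\<in>J. 0 < \<rho>1 t \<and> 0 < \<rho>2 t \<and>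
    (\<rho>1 has_real_derivative
      2 * (real n - 3) - 4 * real n * (sqrt (\<rho>1 t) ^ n / (sqrt (\<rho>1 t) ^ n + sqrt (\<rho>2 t) ^ n)))
      (at t within J) \<and>
    (\<rho>2 has_real_derivative
      2 * (real n + 1) - 4 * real n * (sqrt (\<rho>2 t) ^ n / (sqrt (\<rho>1 t) ^ n + sqrt (\<rho>2 t) ^ n)))
      (at t within J))"

lemma motion_vortex_solution:
  assumes T: "0 < T" and \<rho>: "radii \<rho>1 \<rho>2 (existence_interval T)"
  shows "vortex_solution N m T (motion \<rho>1 \<rho>2)"
  unfolding vortex_solution_def
proof (intro conjI ballI impI T)
  fix t assume t: "t \<in> existence_interval T"
  let ?r1 = "sqrt (\<rho>1 t)" and ?r2 = "sqrt (\<rho>2 t)"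
  have r: "0 < ?r1" "0 < ?r2" using \<rho> t by (auto simp: radii_def)
  show "motion \<rho>1 \<rho>2 j t \<noteq> motion \<rho>1 \<rho>2 k t" if "j \<in> {1..N}" "k \<in> {1..N}" "j \<noteq> k" for j k
    using inj_onD[OF inj_on_config[OF r]] that by (auto simp: motion_def)
  fix j assume j: "j \<in> {1..N}"
  let ?I = "\<Sum>k\<in>{1..N}. of_real (m k) * inverse (config ?r1 ?r2 j - config ?r1 ?r2 k)"
  have "(\<Sum>k\<in>{1..N} - {j}. m k *\<^sub>R ((motion \<rho>1 \<rho>2 j t - motion \<rho>1 \<rho>2 k t)
          /\<^sub>R (norm (motion \<rho>1 \<rho>2 j t - motion \<rho>1 \<rho>2 k t))\<^sup>2))
      = (\<Sum>k\<in>{1..N}. m k *\<^sub>R ((motion \<rho>1 \<rho>2 j t - motion \<rho>1 \<rho>2 k t)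
          /\<^sub>R (norm (motion \<rho>1 \<rho>2 j t - motion \<rho>1 \<rho>2 k t))\<^sup>2))"
    \<comment> \<open>The added term \<open>k = j\<close> is a multiple of the zero vector.\<close>
    by (intro sum.mono_neutral_left) auto
  also have "\<dots> = vec_of_complex (cnj ?I)"
    unfolding motion_def vec_of_complex_simps(4)[symmetric] inversion_vec_of_complex
    by (simp add: vec_of_complex_sum)
  finally have "(2 * m j) *\<^sub>R (\<Sum>k\<in>{1..N} - {j}. m k *\<^sub>R ((motion \<rho>1 \<rho>2 j t - motion \<rho>1 \<rho>2 k t)
          /\<^sub>R (norm (motion \<rho>1 \<rho>2 j t - motion \<rho>1 \<rho>2 k t))\<^sup>2))
      = vec_of_complex (of_real (2 * m j) * cnj ?I)" by (simp only: vec_of_complex_simps)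
  also have "of_real (2 * m j) * cnj ?I = 2 * cnj (of_real (m j) * ?I)" by simp
  finally have force: "(2 * m j) *\<^sub>R (\<Sum>k\<in>{1..N} - {j}. m k *\<^sub>R ((motion \<rho>1 \<rho>2 j t - motion \<rho>1 \<rho>2 k t)
          /\<^sub>R (norm (motion \<rho>1 \<rho>2 j t - motion \<rho>1 \<rho>2 k t))\<^sup>2))
      = vec_of_complex (2 * cnj (of_real (m j) * ?I))" .
  note interaction = config_interaction[OF r j]
  show "(motion \<rho>1 \<rho>2 j has_vector_derivative
      (2 * m j) *\<^sub>R (\<Sum>k\<in>{1..N} - {j}. m k *\<^sub>R ((motion \<rho>1 \<rho>2 j t - motion \<rho>1 \<rho>2 k t)
          /\<^sub>R (norm (motion \<rho>1 \<rho>2 j t - motion \<rho>1 \<rho>2 k t))\<^sup>2)))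
      (at t within existence_interval T)"
    unfolding force using j
  proof (cases rule: index_cases)
    case inner
    let ?c = "(real n - 3) / 2 - real n * (?r1 ^ n / (?r1 ^ n + ?r2 ^ n))"
    have c: "4 * ?c = 2 * (real n - 3) - 4 * real n * (?r1 ^ n / (?r1 ^ n + ?r2 ^ n))"
      by (simp add: field_simps)
    have "(\<rho>1 has_real_derivative 4 * ?c) (at t within existence_interval T)" "0 < \<rho>1 t"
      unfolding c using \<rho> t unfolding radii_def by blast+
    from radial_vector_derivative[OF this, of "\<theta> j"]
    show "(motion \<rho>1 \<rho>2 j has_vector_derivative vec_of_complex (2 * cnj (of_real (m j) * ?I)))
        (at t within existence_interval T)"
      unfolding interaction(1)[OF inner]
      unfolding motion_simps(1)[OF inner] config_simps(1)[OF inner] .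
  next
    case (outer i)
    then have j': "j \<in> {n+1..2*n}" by auto
    let ?c = "(real n + 1) / 2 - real n * (?r2 ^ n / (?r1 ^ n + ?r2 ^ n))"
    have c: "4 * ?c = 2 * (real n + 1) - 4 * real n * (?r2 ^ n / (?r1 ^ n + ?r2 ^ n))"
      by (simp add: field_simps)
    have "(\<rho>2 has_real_derivative 4 * ?c) (at t within existence_interval T)" "0 < \<rho>2 t"
      unfolding c using \<rho> t unfolding radii_def by blast+
    from radial_vector_derivative[OF this, of "\<alpha> i"]
    show "(motion \<rho>1 \<rho>2 j has_vector_derivative vec_of_complex (2 * cnj (of_real (m j) * ?I)))
        (at t within existence_interval T)"
      unfolding interaction(2)[OF j']
      unfolding outer(1) motion_simps(2)[OF outer(2)] config_simps(2)[OF outer(2)] .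
  next
    case centre
    show "(motion \<rho>1 \<rho>2 j has_vector_derivative vec_of_complex (2 * cnj (of_real (m j) * ?I)))
        (at t within existence_interval T)"
      unfolding interaction(3)[OF centre] by (simp add: centre motion_simps)
  qed
qed

text \<open>A smaller \<open>T\<close> would contradict maximality, as the ring motion extends
  \<open>x\<close>; a larger one would contradict the absence of collisions. Decay of the inner
  radius alone fixes \<open>T\<close>, so partial and total collapse are treated together.\<close>

lemma maximal_solution_eq_motion:
  assumes x: "maximal_vortex_solution N m T x"
    and init: "\<And>j. j \<in> {1..N} \<Longrightarrow> x j 0 = motion \<rho>1 \<rho>2 j 0"
    and Tc: "0 < Tc" and \<rho>: "radii \<rho>1 \<rho>2 {0..<Tc}" and lim: "(\<rho>1 \<longlongrightarrow> 0) (at_left Tc)"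
  shows "T = ereal Tc"
    and "\<And>j t. j \<in> {1..N} \<Longrightarrow> t \<in> {0..<Tc} \<Longrightarrow> x j t = motion \<rho>1 \<rho>2 j t"
proof -
  have xs: "vortex_solution N m T x" using x by (simp add: maximal_vortex_solution_def)
  have ys: "vortex_solution N m (ereal Tc) (motion \<rho>1 \<rho>2)"
    using Tc \<rho> by (intro motion_vortex_solution) (simp_all add: existence_interval_ereal)
  have eq: "x j t = motion \<rho>1 \<rho>2 j t"
    if "j \<in> {1..N}" "t \<in> existence_interval T" "t \<in> {0..<Tc}" for j t
    using vortex_solution_unique[OF xs ys init] that by (simp add: existence_interval_ereal)
  have "\<not> T < ereal Tc"
  proof
    assume T: "T < ereal Tc"
    then have "existence_interval T \<subseteq> {0..<Tc}"
      by (auto simp: existence_interval_def dest: less_trans)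
    then have "\<forall>j\<in>{1..N}. \<forall>t \<in> existence_interval T. motion \<rho>1 \<rho>2 j t = x j t"
      using eq by auto
    then show False using x T ys unfolding maximal_vortex_solution_def by blast
  qed
  moreover have "\<not> ereal Tc < T"
  proof
    assume "ereal Tc < T"
    then have TcT: "Tc \<in> existence_interval T" using Tc by (simp add: existence_interval_def)
    have ev: "\<forall>\<^sub>F t in at_left Tc. motion \<rho>1 \<rho>2 j t = x j t" if "j \<in> {1..N}" for j
      using eventually_at_left_real[OF Tc]
    proof eventually_elim
      case (elim t)
      then have "t \<in> existence_interval T" "t \<in> {0..<Tc}"
        using Icc_subset_existence_interval[OF TcT] by auto
      then show ?case using eq[OF that] by simp
    qed
    \<comment> \<open>The first inner vortex and the central one are the colliding pair: both would
      sit at the origin at time \<open>Tc\<close>.\<close>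
    have 1: "1 \<in> {1..N}" "1 \<in> {1..n}" and "N \<in> {1..N}" "N \<noteq> 1" using n N by auto
    have "((\<lambda>t. sqrt (\<rho>1 t) *\<^sub>R direction (\<theta> 1)) \<longlongrightarrow> sqrt 0 *\<^sub>R direction (\<theta> 1)) (at_left Tc)"
      by (intro tendsto_intros lim)
    then have "(motion \<rho>1 \<rho>2 1 \<longlongrightarrow> 0) (at_left Tc)"
      unfolding motion_simps(1)[OF 1(2)] by simp
    then have "(x 1 \<longlongrightarrow> 0) (at_left Tc)" by (rule Lim_transform_eventually[OF _ ev[OF 1(1)]])
    then have "x 1 Tc = 0"
      using vortex_solution_tendsto_at_left[OF xs 1(1) Tc TcT]
      by (rule tendsto_unique[OF trivial_limit_at_left_real, symmetric])
    moreover have "(motion \<rho>1 \<rho>2 N \<longlongrightarrow> 0) (at_left Tc)" by (simp add: motion_simps(3))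
    then have "(x N \<longlongrightarrow> 0) (at_left Tc)"
      by (rule Lim_transform_eventually[OF _ ev[OF \<open>N \<in> {1..N}\<close>]])
    then have "x N Tc = 0"
      using vortex_solution_tendsto_at_left[OF xs \<open>N \<in> {1..N}\<close> Tc TcT]
      by (rule tendsto_unique[OF trivial_limit_at_left_real, symmetric])
    ultimately show False
      using vortex_solution_distinct[OF xs TcT \<open>N \<in> {1..N}\<close> 1(1) \<open>N \<noteq> 1\<close>] by simp
  qed
  ultimately show T: "T = ereal Tc" by order
  show "x j t = motion \<rho>1 \<rho>2 j t" if "j \<in> {1..N}" "t \<in> {0..<Tc}" for j t
    using eq that by (simp add: T existence_interval_ereal)
qed

end

section \<open>Explicit radii for \<open>n = 2\<close>, and the clusters in both cases\<close>

context two_rings begin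

text \<open>For \<open>n = 2\<close> the share is the fraction itself, so in rescaled time
  \<open>s\<close> obeys the linear equation \<open>s' = - 2 - 4 * s\<close>. Then
  \<open>1 + 2 * s\<close> is proportional to \<open>S = \<rho>1 + \<rho>2\<close>, which makes both
  squared radii quadratic in \<open>S\<close>.\<close>

lemma radii_two:
  assumes n2: "n = 2" and R: "0 < R1" "0 < R2"
  obtains \<rho>1 \<rho>2 Tc R where
    "\<rho>1 0 = R1" "\<rho>2 0 = R2" "0 < Tc" "0 < R" "radii \<rho>1 \<rho>2 {0..<Tc}"
    "(\<rho>1 \<longlongrightarrow> 0) (at_left Tc)" "(\<rho>2 \<longlongrightarrow> R) (at_left Tc)"
proof -
  define S0 where "S0 = R1 + R2"
  define S where "S t = S0 - 4 * t" for t
  define c where "c = (S0 + 2 * R1) / S0\<^sup>2"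
  \<comment> \<open>The time at which \<open>c * S\<close> has come down to \<open>1\<close>, where
    \<open>\<rho>1\<close> vanishes and \<open>\<rho>2\<close> equals \<open>1 / c\<close>.\<close>
  define Tc where "Tc = (S0 - 1 / c) / 4"
  \<comment> \<open>The equations conserve \<open>(S + 2 * \<rho>1) / S\<^sup>2 = c\<close>, where \<open>S = \<rho>1 + \<rho>2\<close>.\<close>
  define \<rho>1 where "\<rho>1 t = S t * (c * S t - 1) / 2" for t
  define \<rho>2 where "\<rho>2 t = S t * (3 - c * S t) / 2" for t
  have S0: "0 < S0" using R by (simp add: S0_def)
  have cS0: "c * S0 = 1 + 2 * R1 / S0" using S0 by (simp add: c_def field_simps power2_eq_square)
  have "0 < 2 * R1 / S0" "2 * R1 / S0 < 2" using R S0 by (simp_all add: field_simps, simp_all add: S0_def)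
  \<comment> \<open>Up to \<open>Tc\<close> the product \<open>c * S\<close> decreases from
    \<open>c * S0 < 3\<close> towards \<open>1\<close>, so the factors \<open>c * S - 1\<close> and
    \<open>3 - c * S\<close> are positive on \<open>{0..<Tc}\<close>.\<close>
  then have cS0_bounds: "1 < c * S0" "c * S0 < 3" unfolding cS0 by linarith+
  have c: "0 < c" using R S0 by (simp add: c_def)
  have STc: "S Tc = 1 / c" by (simp add: S_def Tc_def diff_divide_distrib)
  have dS: "(S has_real_derivative - 4) (at t within J)" for t J
    unfolding S_def by (auto intro!: derivative_eq_intros)
  have lim_S: "(S \<longlongrightarrow> 1 / c) (at_left Tc)"
    unfolding STc[symmetric] using DERIV_continuous[OF dS[of Tc UNIV]]
    by (auto simp: continuous_at intro: tendsto_within_subset)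
  show thesis
  proof (rule that[of \<rho>1 \<rho>2 Tc "1 / c"])
    have "\<rho>1 0 = S0 * (2 * R1 / S0) / 2" by (simp add: \<rho>1_def S_def cS0)
    then show "\<rho>1 0 = R1" using S0 by simp
    have "\<rho>2 0 = S0 * (2 - 2 * R1 / S0) / 2" by (simp add: \<rho>2_def S_def cS0)
    also have "\<dots> = S0 - R1" using S0 by (simp add: right_diff_distrib diff_divide_distrib)
    finally show "\<rho>2 0 = R2" by (simp add: S0_def)
    show "0 < Tc" using cS0_bounds c by (simp add: Tc_def field_simps)
    show "0 < 1 / c" using c by simp
    have "(\<rho>1 \<longlongrightarrow> 1 / c * (c * (1 / c) - 1) / 2) (at_left Tc)"
      unfolding \<rho>1_def by (intro tendsto_intros lim_S) simp
    then show "(\<rho>1 \<longlongrightarrow> 0) (at_left Tc)" using c by simp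
    have "(\<rho>2 \<longlongrightarrow> 1 / c * (3 - c * (1 / c)) / 2) (at_left Tc)"
      unfolding \<rho>2_def by (intro tendsto_intros lim_S) simp
    then show "(\<rho>2 \<longlongrightarrow> 1 / c) (at_left Tc)" using c by simp
    show "radii \<rho>1 \<rho>2 {0..<Tc}"
      unfolding radii_def
    proof (intro ballI)
      fix t assume t: "t \<in> {0..<Tc}"
      then have "S Tc < S t" "S t \<le> S0" by (auto simp: S_def)
      then have "c * S Tc < c * S t" "c * S t \<le> c * S0" using c by simp_all
      moreover have "c * S Tc = 1" using c by (simp add: STc)
      ultimately have cS: "1 < c * S t" "c * S t < 3" using cS0_bounds(2) by linarith+
      have St: "0 < S t" by (rule zero_less_mult_pos[OF _ c]) (use cS in linarith)
      have pos: "0 < \<rho>1 t" "0 < \<rho>2 t" using cS St by (simp_all add: \<rho>1_def \<rho>2_def)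
      have sum: "\<rho>1 t + \<rho>2 t = S t" by (simp add: \<rho>1_def \<rho>2_def field_simps)
      have d1: "(\<rho>1 has_real_derivative 2 - 4 * (c * S t)) (at t within {0..<Tc})"
        unfolding \<rho>1_def by (auto intro!: derivative_eq_intros dS simp: field_simps)
      have d2: "(\<rho>2 has_real_derivative 4 * (c * S t) - 6) (at t within {0..<Tc})"
        unfolding \<rho>2_def by (auto intro!: derivative_eq_intros dS simp: field_simps)
      have q: "\<rho>1 t / S t = (c * S t - 1) / 2" "\<rho>2 t / S t = (3 - c * S t) / 2"
        using St by (simp_all add: \<rho>1_def \<rho>2_def)
      have sq: "sqrt (\<rho>1 t) ^ n = \<rho>1 t" "sqrt (\<rho>2 t) ^ n = \<rho>2 t" using pos by (simp_all add: n2)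
      show "0 < \<rho>1 t \<and> 0 < \<rho>2 t \<and>
        (\<rho>1 has_real_derivative
          2 * (real n - 3) - 4 * real n * (sqrt (\<rho>1 t) ^ n / (sqrt (\<rho>1 t) ^ n + sqrt (\<rho>2 t) ^ n)))
          (at t within {0..<Tc}) \<and>
        (\<rho>2 has_real_derivative
          2 * (real n + 1) - 4 * real n * (sqrt (\<rho>2 t) ^ n / (sqrt (\<rho>1 t) ^ n + sqrt (\<rho>2 t) ^ n)))
          (at t within {0..<Tc})"
        unfolding sq sum q
        by (intro conjI pos DERIV_cong[OF d1] DERIV_cong[OF d2]) (simp_all add: n2 field_simps)
    qed
  qed
qed

lemma maximal_solution_tendsto:
  assumes eq: "\<And>j t. j \<in> {1..N} \<Longrightarrow> t \<in> {0..<Tc} \<Longrightarrow> x j t = motion \<rho>1 \<rho>2 j t"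
    and Tc: "0 < Tc" and lim: "(\<rho>1 \<longlongrightarrow> R1) (at_left Tc)" "(\<rho>2 \<longlongrightarrow> R2) (at_left Tc)"
    and j: "j \<in> {1..N}"
  shows "(x j \<longlongrightarrow> vec_of_complex (config (sqrt R1) (sqrt R2) j)) (at_left Tc)"
proof (rule Lim_transform_eventually[OF motion_tendsto[OF lim j]])
  show "\<forall>\<^sub>F t in at_left Tc. motion \<rho>1 \<rho>2 j t = x j t"
    using eventually_at_left_real[OF Tc] by eventually_elim (simp add: eq[OF j])
qed

lemma total_collision:
  assumes x: "vortex_solution N m (ereal Tc) x"
    and lim: "\<And>j. j \<in> {1..N} \<Longrightarrow> (x j \<longlongrightarrow> 0) (at_left Tc)"
  shows "cluster_collides_at N (ereal Tc) x {1..N} Tc 0"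
proof -
  have "0 < Tc" using x by (simp add: vortex_solution_def)
  moreover have "0 < Min {dist (x j t) (x l t) | j l. 1 \<le> j \<and> j < l \<and> l \<le> N}"
    if "0 \<le> t" "t < Tc" for t
    using vortex_solution_Min_dist_pos[OF x] that n by (simp add: existence_interval_ereal N)
  ultimately show ?thesis
    unfolding cluster_collides_at_def using lim n by (simp add: N)
qed

text \<open>In the limit the vortices \<open>1\<close>, \<open>2\<close>, \<open>5\<close> sit at
  the origin, and \<open>3\<close>, \<open>4\<close> at two distinct points of the circle of radius
  \<open>sqrt R\<close>. Every cluster is a fibre of this limit map with at least two elements, so
  there is just one.\<close>

lemma inner_collision:
  assumes x: "vortex_solution N m (ereal Tc) x" and n2: "n = 2" and R: "0 < R"
    and lim: "\<And>j. j \<in> {1..N} \<Longrightarrow> (x j \<longlongrightarrow> vec_of_complex (config 0 (sqrt R) j)) (at_left Tc)"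
  shows "cluster_collides_at N (ereal Tc) x {1, 2, 5} Tc 0"
    and "collision_cluster N (ereal Tc) x I \<Longrightarrow> I = {1, 2, 5}"
proof -
  define L where "L j = vec_of_complex (config 0 (sqrt R) j)" for j
  have N5: "N = 5" "{1..N} = {1, 2, 3, 4, 5}" using N n2 by auto
  have L0: "L 1 = 0" "L 2 = 0" "L 5 = 0" unfolding L_def config_def by (simp_all add: n2)
  have normL: "norm (L 3) = sqrt R" "norm (L 4) = sqrt R"
    using R unfolding L_def config_def by (simp_all add: n2 norm_mult)
  \<comment> \<open>Injectivity of \<open>config\<close> is available for positive radii; indices
    above \<open>2\<close> do not see the inner radius, so \<open>0\<close> may be traded for
    \<open>1\<close>.\<close>
  have "config 0 (sqrt R) l = config 1 (sqrt R) l" if "2 < l" for l using that by (simp add: config_def) (simp add: n2)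
  moreover have "config 1 (sqrt R) 3 \<noteq> config 1 (sqrt R) 4"
    using inj_on_eq_iff[OF inj_on_config[of 1 "sqrt R"], of 3 4] R by (simp add: N5(1))
  ultimately have L34: "L 3 \<noteq> L 4" by (simp add: L_def)
  have lim': "(x j \<longlongrightarrow> L j) (at_left Tc)" if "j \<in> {1..N}" for j
    unfolding L_def by (rule lim[OF that])
  have "0 < Tc" using x by (simp add: vortex_solution_def)
  moreover have "0 < Min {dist (x j t) (x l t) | j l. 1 \<le> j \<and> j < l \<and> l \<le> N}"
    if "0 \<le> t" "t < Tc" for t
    using vortex_solution_Min_dist_pos[OF x] that by (simp add: existence_interval_ereal N5)
  moreover have "(x j \<longlongrightarrow> 0) (at_left Tc)" if "j \<in> {1, 2, 5}" for j
  proof -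
    have j: "j \<in> {1..N}" and "L j = 0" using that L0 N5(1) by auto
    then show ?thesis using lim'[OF j] by (simp only:)
  qed
  moreover have "0 < Min ((\<lambda>j. dist (x j t) (x l t)) ` {1, 2, 5})"
    if l: "l \<in> {1..N} - {1, 2, 5}" and t: "0 \<le> t" "t < Tc" for l t
  proof -
    have "0 < dist (x j t) (x l t)" if "j \<in> {1, 2, 5}" for j
      unfolding zero_less_dist_iff
      by (rule vortex_solution_distinct[OF x]) (use l t that N5(1) in \<open>auto simp: existence_interval_ereal\<close>)
    then show ?thesis by simp
  qed
  moreover have "\<exists>d>0. ((\<lambda>t. Min ((\<lambda>j. dist (x j t) (x l t)) ` {1, 2, 5})) \<longlongrightarrow> d) (at_left Tc)"
    if l: "l \<in> {1..N} - {1, 2, 5}" for l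
  proof -
    have l34: "l = 3 \<or> l = 4" using l unfolding N5(2) by blast
    have "((\<lambda>t. dist (x j t) (x l t)) \<longlongrightarrow> sqrt R) (at_left Tc)" if j: "j \<in> {1, 2, 5}" for j
    proof -
      have "dist (L j) (L l) = sqrt R" using j L0 normL l34 by (auto simp: dist_norm)
      moreover have "j \<in> {1..N}" "l \<in> {1..N}" using j l N5(1) by auto
      then have "((\<lambda>t. dist (x j t) (x l t)) \<longlongrightarrow> dist (L j) (L l)) (at_left Tc)"
        by (intro tendsto_dist lim')
      ultimately show ?thesis by simp
    qed
    \<comment> \<open>The minimum over the three members unfolds to nested binary minima, whose
      arguments all have the limit \<open>sqrt R\<close>.\<close>
    then have "((\<lambda>t. min (dist (x 1 t) (x l t)) (min (dist (x 2 t) (x l t)) (dist (x 5 t) (x l t))))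
        \<longlongrightarrow> min (sqrt R) (min (sqrt R) (sqrt R))) (at_left Tc)"
      by (intro tendsto_min) simp_all
    then have "((\<lambda>t. Min ((\<lambda>j. dist (x j t) (x l t)) ` {1, 2, 5})) \<longlongrightarrow> sqrt R) (at_left Tc)"
      by simp
    then show ?thesis using R by (intro exI[of _ "sqrt R"]) simp
  qed
  ultimately show "cluster_collides_at N (ereal Tc) x {1, 2, 5} Tc 0"
    unfolding cluster_collides_at_def by (simp add: N5(1))
  show "I = {1, 2, 5}" if I: "collision_cluster N (ereal Tc) x I"
  proof -
    obtain Tc' p where c: "cluster_collides_at N (ereal Tc) x I Tc' p"
      using I unfolding collision_cluster_def by blast
    then have "Tc' = Tc" using cluster_collision_time[OF x c] by simp
    with c have "cluster_collides_at N (ereal Tc) x I Tc p" by simp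
    then have I_eq: "I = {j \<in> {1..N}. L j = p}" using lim' by (rule cluster_eq_limit_fibre)
    obtain j k where jk: "j \<in> I" "k \<in> I" "j \<noteq> k" by (rule cluster_obtain_pair[OF c])
    have nz: "L 3 \<noteq> 0" "L 4 \<noteq> 0" using normL R by auto
    have "p = 0" using jk L0 nz L34 unfolding I_eq N5(2) by auto
    then show ?thesis using L0 nz unfolding I_eq N5(2) by auto
  qed
qed

end

theorem proposition4p8:
  fixes n N :: nat and m0 \<theta>0 a1 a2 :: real
    and m \<theta> \<alpha> :: "nat \<Rightarrow> real"
    and x :: "nat \<Rightarrow> real \<Rightarrow> real ^ 2" and T :: ereal
  assumes "2 \<le> n" and "N = 2 * n + 1"
    and "m0 \<in> {1, -1}" and "m N = - m0"
    and "\<And>j. j \<in> {1..n} \<Longrightarrow> m j = m0"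
    and "\<And>j. j \<in> {1..n} \<Longrightarrow> m (n + j) = - m0"
    and "0 \<le> \<theta>0" and "\<theta>0 < 2 * pi"
    and "0 < a1" and "a1 < a2"
    and "\<And>j. j \<in> {1..n} \<Longrightarrow> \<theta> j = 2 * (real j - 1) * pi / real n + \<theta>0"
    and "\<And>j. j \<in> {1..n} \<Longrightarrow> \<alpha> j = 2 * (real j - 1) * pi / real n + pi / real n + \<theta>0"
    and "maximal_vortex_solution N m T x"
    and "x N 0 = 0"
    and "\<And>j. j \<in> {1..n} \<Longrightarrow> x j 0 = a1 *\<^sub>R direction (\<theta> j)"
    and "\<And>j. j \<in> {1..n} \<Longrightarrow> x (n + j) 0 = a2 *\<^sub>R direction (\<alpha> j)"
  shows "(\<exists>\<rho>1 \<rho>2 :: real \<Rightarrow> real. \<forall>t \<in> existence_interval T.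
            0 \<le> \<rho>1 t \<and> 0 \<le> \<rho>2 t \<and>
            x N t = 0 \<and>
            (\<forall>j\<in>{1..n}. x j t = sqrt (\<rho>1 t) *\<^sub>R direction (\<theta> j)) \<and>
            (\<forall>j\<in>{1..n}. x (n + j) t = sqrt (\<rho>2 t) *\<^sub>R direction (\<alpha> j)))
       \<and> (n = 2 \<longrightarrow>
            (\<forall>I. collision_cluster N T x I \<longleftrightarrow> I = {1, 2, 5}) \<and>
            (\<exists>Tc. cluster_collides_at N T x {1, 2, 5} Tc 0))
       \<and> (3 \<le> n \<longrightarrow>
            collision_cluster N T x {1..N} \<and>
            cluster_collides_at N T x {1..N} ((a1\<^sup>2 + a2\<^sup>2) / 4) 0)"
proof -
  interpret two_rings n N m0 \<theta>0 m \<theta> \<alpha>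
    by (intro two_rings.intro) (fact assms)+
  note max = \<open>maximal_vortex_solution N m T x\<close>
  have xs: "vortex_solution N m T x" using max by (simp add: maximal_vortex_solution_def)
  have a: "0 < a1\<^sup>2" "0 < a2\<^sup>2" using \<open>0 < a1\<close> \<open>a1 < a2\<close> by auto
  \<comment> \<open>The radii start at the squares of \<open>a1\<close> and \<open>a2\<close>, and
    positivity gives back \<open>sqrt (a1\<^sup>2) = a1\<close> and
    \<open>sqrt (a2\<^sup>2) = a2\<close>.\<close>
  have init: "x j 0 = motion \<rho>1 \<rho>2 j 0"
    if "\<rho>1 0 = a1\<^sup>2" "\<rho>2 0 = a2\<^sup>2" "j \<in> {1..N}" for \<rho>1 \<rho>2 j
    using that(3)
  proof (cases rule: index_cases)
    case inner
    then show ?thesis using assms(9,15) that(1) by (simp add: motion_simps)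
  next
    case (outer i)
    then show ?thesis using assms(9,10,16) that(2) by (simp add: motion_simps)
  next
    case centre
    then show ?thesis using \<open>x N 0 = 0\<close> by (simp add: motion_simps)
  qed
  have form: "\<exists>\<rho>1 \<rho>2 :: real \<Rightarrow> real. \<forall>t \<in> existence_interval T.
            0 \<le> \<rho>1 t \<and> 0 \<le> \<rho>2 t \<and>
            x N t = 0 \<and>
            (\<forall>j\<in>{1..n}. x j t = sqrt (\<rho>1 t) *\<^sub>R direction (\<theta> j)) \<and>
            (\<forall>j\<in>{1..n}. x (n + j) t = sqrt (\<rho>2 t) *\<^sub>R direction (\<alpha> j))"
    if "T = ereal Tc" "radii \<rho>1 \<rho>2 {0..<Tc}"
      and eq: "\<And>j t. j \<in> {1..N} \<Longrightarrow> t \<in> {0..<Tc} \<Longrightarrow> x j t = motion \<rho>1 \<rho>2 j t" for Tc \<rho>1 \<rho>2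
  proof (rule exI[of _ \<rho>1], rule exI[of _ \<rho>2], intro ballI conjI)
    fix t assume "t \<in> existence_interval T"
    then have t: "t \<in> {0..<Tc}" using that(1) by (simp add: existence_interval_ereal)
    have "0 < \<rho>1 t" "0 < \<rho>2 t" using that(2) t unfolding radii_def by blast+
    then show "0 \<le> \<rho>1 t" "0 \<le> \<rho>2 t" by simp_all
    have "N \<in> {1..N}" by (simp add: N)
    from eq[OF this t] show "x N t = 0" by (simp only: motion_simps)
    show "x j t = sqrt (\<rho>1 t) *\<^sub>R direction (\<theta> j)" if "j \<in> {1..n}" for j
      using eq[OF _ t, of j] that by (simp add: motion_simps N)
    show "x (n + j) t = sqrt (\<rho>2 t) *\<^sub>R direction (\<alpha> j)" if "j \<in> {1..n}" for j
      using eq[OF _ t, of "n + j"] that by (simp add: motion_simps N)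
  qed
  consider "n = 2" | "3 \<le> n" using n by linarith
  then show ?thesis
  proof cases
    case 1
    obtain \<rho>1 \<rho>2 Tc R where \<rho>: "\<rho>1 0 = a1\<^sup>2" "\<rho>2 0 = a2\<^sup>2" and Tc: "0 < Tc" and R: "0 < R"
      and radii: "radii \<rho>1 \<rho>2 {0..<Tc}"
      and lim: "(\<rho>1 \<longlongrightarrow> 0) (at_left Tc)" "(\<rho>2 \<longlongrightarrow> R) (at_left Tc)"
      by (rule radii_two[OF 1 a])
    note sol = maximal_solution_eq_motion[OF max init[of \<rho>1 \<rho>2, OF \<rho>] Tc radii lim(1)]
    have "(x j \<longlongrightarrow> vec_of_complex (config 0 (sqrt R) j)) (at_left Tc)" if "j \<in> {1..N}" for j
      using maximal_solution_tendsto[OF sol(2) Tc lim that] by simp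
    moreover have "vortex_solution N m (ereal Tc) x" using xs sol(1) by simp
    ultimately have coll: "cluster_collides_at N T x {1, 2, 5} Tc 0"
      "\<And>I. collision_cluster N T x I \<Longrightarrow> I = {1, 2, 5}"
      using inner_collision[of Tc x R] 1 R sol(1) by simp_all
    show ?thesis
      using form[OF sol(1) radii sol(2)] coll 1 unfolding collision_cluster_def by auto
  next
    case 2
    define Tc where "Tc = (a1\<^sup>2 + a2\<^sup>2) / 4"
    have Tc: "0 < Tc" using add_pos_pos[OF a] by (simp add: Tc_def)
    obtain \<rho>1 \<rho>2 where \<rho>: "\<rho>1 0 = a1\<^sup>2" "\<rho>2 0 = a2\<^sup>2"
      and sum: "\<And>t. t \<in> {0..<Tc} \<Longrightarrow> 0 < \<rho>1 t \<and> 0 < \<rho>2 t \<and> \<rho>1 t + \<rho>2 t = a1\<^sup>2 + a2\<^sup>2 - 4 * t"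
      and radii: "radii \<rho>1 \<rho>2 {0..<Tc}"
      by (rule radii_exist[OF 2 a, folded Tc_def]) (simp add: radii_def)
    have "((\<lambda>t. a1\<^sup>2 + a2\<^sup>2 - 4 * t) \<longlongrightarrow> a1\<^sup>2 + a2\<^sup>2 - 4 * Tc) (at_left Tc)"
      by (intro tendsto_intros)
    moreover have "a1\<^sup>2 + a2\<^sup>2 - 4 * Tc = 0" by (simp add: Tc_def)
    ultimately have S: "((\<lambda>t. a1\<^sup>2 + a2\<^sup>2 - 4 * t) \<longlongrightarrow> 0) (at_left Tc)" by (simp only:)
    \<comment> \<open>Each squared radius lies between \<open>0\<close> and the sum, and the sum
      vanishes at \<open>Tc\<close>; both rings therefore reach the centre simultaneously.\<close>
    have lim: "(\<rho> \<longlongrightarrow> 0) (at_left Tc)"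
      if "\<And>t. t \<in> {0..<Tc} \<Longrightarrow> 0 \<le> \<rho> t \<and> \<rho> t \<le> a1\<^sup>2 + a2\<^sup>2 - 4 * t" for \<rho>
    proof (rule tendsto_sandwich[OF _ _ tendsto_const S])
      show "\<forall>\<^sub>F t in at_left Tc. 0 \<le> \<rho> t" "\<forall>\<^sub>F t in at_left Tc. \<rho> t \<le> a1\<^sup>2 + a2\<^sup>2 - 4 * t"
        using eventually_at_left_real[OF Tc] by (eventually_elim, use that in force)+
    qed
    have lim: "(\<rho>1 \<longlongrightarrow> 0) (at_left Tc)" "(\<rho>2 \<longlongrightarrow> 0) (at_left Tc)"
      by (rule lim; use sum in fastforce)+
    note sol = maximal_solution_eq_motion[OF max init[of \<rho>1 \<rho>2, OF \<rho>] Tc radii lim(1)]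
    have "(x j \<longlongrightarrow> 0) (at_left Tc)" if "j \<in> {1..N}" for j
    proof -
      have "config 0 0 j = 0" by (simp add: config_def)
      then show ?thesis using maximal_solution_tendsto[OF sol(2) Tc lim that] by simp
    qed
    moreover have "vortex_solution N m (ereal Tc) x" using xs sol(1) by simp
    ultimately have coll: "cluster_collides_at N T x {1..N} Tc 0"
      using total_collision[of Tc x] sol(1) by simp
    show ?thesis
      using form[OF sol(1) radii sol(2)] coll 2 unfolding collision_cluster_def Tc_def by auto
  qed
qed

end
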